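(* Let $\Sigma$ be an alphabet of size $\Delta$, let $P$ be any pattern string of length $n$ over $\Sigma$, and let $T$ be a query string of length $m$ whose characters are drawn independently and uniformly at random from $\Sigma$. Then Algorithms $A$ and $B$ (described in the context) find all occurrences of $P$ in $T$ in $O(m/\min(|sparse(P)|,\Delta))$ expected time, where $|sparse(P)|\ge \delta$, the number of distinct characters of $P$.
   Context: Strings are indexed from 1. For an ordered pair of characters $u,v\in\Sigma$ (not necessarily distinct), $sparse^{(u,v)}(P)$ is the rightmost occurrence in $P$ of a substring of $P$ of longest length that starts with $u$, ends with $v$, and contains no occurrence of $u$ or $v$ strictly inside it. $sparse(P)$ is the longest among the patterns $sparse^{(u,v)}(P)$; $|sparse(P)|$ is its length. $startc(P)$, $endc(P)$ are its first and last characters and $startpos(P)$, $endpos(P)$ their indices in $P$. For $c\in\Sigma$: if $c$ occurs in $sparse(P)$, $shift^{c}(P)$ is the distance between the rightmost occurrence of $c$ in $sparse(P)$ and the last character of $sparse(P)$; if $c$ does not occur in $P$, $shift^{c}(P)=n$; if $c$ occurs in $P$ but not in $sparse(P)$, $shift^{c}(P)=|sparse(P)|+1$. $N_i(P)$ is the length of the longest suffix of $P[1..i]$ matching a suffix of $P$; $M$ is a length-$m$ array with $M[j]=k$ recording that a suffix of $P$ of length at least $k$ occurs in $T$ ending at $j$. Algorithm $A$. Preprocessing: compute $N_i(P)$, all $sparse^{(u,v)}(P)$, $sparse(P)$, $startc(P)$, $endc(P)$, $startpos(P)$, $endpos(P)$ and all $shift^{c}(P)$. Search: set $i=0$, $j=n$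 (window $T[i+1..j]$), $\hat i=startpos(P)$, $\hat j=endpos(P)$. While the window is contained in $T$: let $c=T[i+\hat j]$, $d=T[i+\hat i]$. (Type-1) If $c\ne endc(P)$, increase $i,j$ by $shift^{c}(P)$. (Type-2) Else if $d\ne startc(P)$, increase $i,j$ by $|sparse(P)|$ if $startc(P)=endc(P)$, else by $|sparse(P)|+1$. (Type-3) Else run the Apostolico–Giancarlo algorithm (with $N$, $M$ kept globally across invocations) to test whether $P$ occurs at window $T[i+1..j]$, report it if so, then increase $i,j$ by $|sparse(P)|$ if $startc(P)=endc(P)$, else by $|sparse(P)|+1$. Algorithm $B$ is identical to $A$ except that in a Type-3 event, instead of Apostolico–Giancarlo, it calls Random-Match, which inspects the $n$ aligned pairs ($P[k]$ vs. $T[i+k]$) in a random order until it encounters a mismatch or finds all $n$ pairs matching.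
   Formalization: The stated shifts can skip occurrences, so finding all is proved with |sparse(P)| in shifts replaced by endpos−startpos (at least 1) and n by endpos; the stated shifts get the time bound and no false reports. B's time bound needs Δ≥2. Time is search time, without preprocessing. *)

theory Defs
  imports "HOL-Probability.Probability" "HOL-Library.Sublist"
begin

text \<open>Strings are lists, but positions are counted from 1.\<close>

abbreviation ch :: "'a list \<Rightarrow> nat \<Rightarrow> 'a" where
  "ch s k \<equiv> s ! (k - 1)"

text \<open>A substring occurrence \<open>P[a..b]\<close> is the pair \<open>(a, b)\<close> of its end positions.\<close>

definition sublen :: "nat \<Rightarrow> nat \<Rightarrow> nat" where
  "sublen a b = b + 1 - a"

definition sparse_cands :: "'a list \<Rightarrow> 'a \<Rightarrow> 'a \<Rightarrow> (nat \<times> nat) set" where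
  "sparse_cands P u v =
     {(a, b). 1 \<le> a \<and> a \<le> b \<and> b \<le> length P \<and> ch P a = u \<and> ch P b = v \<and>
              (\<forall>k. a < k \<and> k < b \<longrightarrow> ch P k \<noteq> u \<and> ch P k \<noteq> v)}"

definition is_sparse_for :: "'a list \<Rightarrow> 'a \<Rightarrow> 'a \<Rightarrow> nat \<Rightarrow> nat \<Rightarrow> bool" where
  "is_sparse_for P u v a b \<longleftrightarrow>
     (a, b) \<in> sparse_cands P u v \<and>
     (\<forall>(a', b') \<in> sparse_cands P u v.
        sublen a' b' < sublen a b \<or> sublen a' b' = sublen a b \<and> b' \<le> b)"

text \<open>
  \<open>sparse(P)\<close> is unique only up to ties between different pairs \<open>(u, v)\<close>, so it is a relation:
  every choice \<open>(a, b) = (startpos(P), endpos(P))\<close> of a longest one is admitted.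
\<close>

definition is_sparse :: "'a list \<Rightarrow> nat \<Rightarrow> nat \<Rightarrow> bool" where
  "is_sparse P a b \<longleftrightarrow>
     (\<exists>u v. is_sparse_for P u v a b) \<and>
     (\<forall>u' v' a' b'. is_sparse_for P u' v' a' b' \<longrightarrow> sublen a' b' \<le> sublen a b)"

definition shift_in_sparse :: "'a list \<Rightarrow> nat \<Rightarrow> nat \<Rightarrow> 'a \<Rightarrow> nat" where
  "shift_in_sparse P a b c = b - Max {k \<in> {a..b}. ch P k = c}"

definition stated_shift :: "'a list \<Rightarrow> nat \<Rightarrow> nat \<Rightarrow> 'a \<Rightarrow> nat" where
  "stated_shift P a b c =
     (if c \<in> ch P ` {a..b} then shift_in_sparse P a b c
      else if c \<notin> set P then length P
      else sublen a b + 1)"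

definition stated_jump :: "'a list \<Rightarrow> nat \<Rightarrow> nat \<Rightarrow> nat" where
  "stated_jump P a b = (if ch P a = ch P b then sublen a b else sublen a b + 1)"

definition stated :: "'a list \<Rightarrow> nat \<Rightarrow> nat \<Rightarrow> ('a \<Rightarrow> nat) \<times> nat" where
  "stated P a b = (stated_shift P a b, stated_jump P a b)"

text \<open>
  With these tables the search skips occurrences: each of the four displacements other
  than \<open>shift_in_sparse\<close> does so on some input (lemmas \<open>stated_jump_misses\<close> and
  \<open>stated_shift_misses\<close>, with their primed variants, below).  The amended tables differ in two respects: where \<open>|sparse(P)|\<close> is used as a displacement it is the distance
  \<open>endpos(P) - startpos(P) = |sparse(P)| - 1\<close> between the end characters, as in the definition of
  \<open>shift\<^sup>c\<close> for \<open>c\<close> in \<open>sparse(P)\<close>; and for \<open>c\<close> not in \<open>P\<close>, which is seen at offset \<open>endpos(P)\<close>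
  of the window, the window moves just past it.  The \<open>max\<close> concerns patterns of length 1 only,
  where that distance is 0.
\<close>

definition amended_shift :: "'a list \<Rightarrow> nat \<Rightarrow> nat \<Rightarrow> 'a \<Rightarrow> nat" where
  "amended_shift P a b c =
     (if c \<in> ch P ` {a..b} then shift_in_sparse P a b c
      else if c \<notin> set P then b
      else (b - a) + 1)"

definition amended_jump :: "'a list \<Rightarrow> nat \<Rightarrow> nat \<Rightarrow> nat" where
  "amended_jump P a b = (if ch P a = ch P b then max 1 (b - a) else (b - a) + 1)"

definition amended :: "'a list \<Rightarrow> nat \<Rightarrow> nat \<Rightarrow> ('a \<Rightarrow> nat) \<times> nat" where
  "amended P a b = (amended_shift P a b, amended_jump P a b)"

text \<open>
  A verifier tests the window \<open>T[i+1..i+n]\<close>.  Given its persistent state, it returns the answer,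
  the number of its elementary steps, and the new state.
\<close>

type_synonym ('a, 's) verifier =
  "'a list \<Rightarrow> 'a list \<Rightarrow> nat \<Rightarrow> 's \<Rightarrow> (bool \<times> nat \<times> 's) pmf"

text \<open>
  The main loop, from window offset \<open>i\<close> on.  The result is the set of reported offsets and the
  running time: one unit for each text character the loop reads, plus the steps of the verifier.
  The \<open>max 1\<close> makes the recursion total for arbitrary tables; the tables above are positive
  wherever the loop consults them.
\<close>

function search ::
  "('a, 's) verifier \<Rightarrow> ('a \<Rightarrow> nat) \<times> nat \<Rightarrow> 'a list \<Rightarrow> nat \<Rightarrow> nat \<Rightarrow> 'a list \<Rightarrow> nat \<Rightarrow> 's
     \<Rightarrow> (nat set \<times> nat) pmf" where
  "search V D P a b T i s =
     (if length T < i + length P then return_pmf ({}, 0)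
      else if ch T (i + b) \<noteq> ch P b then
        map_pmf (\<lambda>(R, t). (R, t + 1)) (search V D P a b T (i + max 1 (fst D (ch T (i + b)))) s)
      else if ch T (i + a) \<noteq> ch P a then
        map_pmf (\<lambda>(R, t). (R, t + 2)) (search V D P a b T (i + max 1 (snd D)) s)
      else do {
        (found, t', s') \<leftarrow> V P T i s;
        map_pmf (\<lambda>(R, t). (if found then insert i R else R, t + 2 + t'))
          (search V D P a b T (i + max 1 (snd D)) s')
      })"
  by pat_completeness auto
termination
  by (relation "Wellfounded.measure (\<lambda>(V, D, P, a, b, T, i, s). Suc (length T) - i)") auto

declare search.simps [simp del]

lemma search_end:
  "length T < i + length P \<Longrightarrow> search V D P a b T i s = return_pmf ({}, 0)"
  by (simp add: search.simps)

text \<open>\<open>N\<^sub>k(P)\<close>\<close>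

definition suffix_len :: "'a list \<Rightarrow> nat \<Rightarrow> nat" where
  "suffix_len P k = Max {length w | w. suffix w (take k P) \<and> suffix w P}"

text \<open>
  One phase of the Apostolico--Giancarlo algorithm on the window \<open>T[i+1..i+n]\<close>, scanning from
  right to left: \<open>P[k+1..n]\<close> is known to match and \<open>P[k]\<close> faces \<open>T[i+k]\<close>.  The value 0 of
  \<open>M\<close> also stands for an undefined entry.  The result is the answer, the number of iterations, and
  the length of a suffix of \<open>P\<close> that has been found to end at \<open>i + n\<close>.
\<close>

function ag_scan :: "'a list \<Rightarrow> 'a list \<Rightarrow> (nat \<Rightarrow> nat) \<Rightarrow> nat \<Rightarrow> nat \<Rightarrow> bool \<times> nat \<times> nat" where
  "ag_scan P T M i k =
     (if k = 0 then (True, 0, length P)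
      else if M (i + k) = 0 then
        (if ch P k = ch T (i + k) then
           (case ag_scan P T M i (k - 1) of (found, t, l) \<Rightarrow> (found, t + 1, l))
         else (False, 1, length P - k))
      else if M (i + k) < suffix_len P k \<or> M (i + k) = suffix_len P k \<and> suffix_len P k < k then
        (case ag_scan P T M i (k - M (i + k)) of (found, t, l) \<Rightarrow> (found, t + 1, l))
      else if suffix_len P k = k then (True, 1, length P)
      else (False, 1, length P - k + suffix_len P k))"
  by pat_completeness auto
termination
  by (relation "Wellfounded.measure (\<lambda>(P, T, M, i, k). k)") auto

declare ag_scan.simps [simp del]

definition apostolico_giancarlo :: "('a, nat \<Rightarrow> nat) verifier" where
  "apostolico_giancarlo P T i M =
     (case ag_scan P T M i (length P) of
        (found, t, l) \<Rightarrow> return_pmf (found, t, M(i + length P := l)))"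

fun match_in_order :: "'a list \<Rightarrow> 'a list \<Rightarrow> nat \<Rightarrow> nat list \<Rightarrow> bool \<times> nat" where
  "match_in_order P T i [] = (True, 0)"
| "match_in_order P T i (k # ks) =
     (if ch P k = ch T (i + k)
      then (case match_in_order P T i ks of (found, t) \<Rightarrow> (found, t + 1))
      else (False, 1))"

text \<open>
  Over a one-letter alphabet every pair matches and each call takes \<open>n\<close> steps; the loop then needs
  about \<open>n * (m - n)\<close> steps, which no absolute constant times \<open>m\<close> bounds.
\<close>

definition random_match :: "('a, unit) verifier" where
  "random_match P T i s = do {
     ks \<leftarrow> pmf_of_set (permutations_of_set {1..length P});
     (case match_in_order P T i ks of (found, t) \<Rightarrow> return_pmf (found, t, ()))
   }"

definition algorithm_A ::
  "('a \<Rightarrow> nat) \<times> nat \<Rightarrow> 'a list \<Rightarrow> nat \<Rightarrow> nat \<Rightarrow> 'a list \<Rightarrow> (nat set \<times> nat) pmf" where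
  "algorithm_A D P a b T = search apostolico_giancarlo D P a b T 0 (\<lambda>_. 0)"

definition algorithm_B ::
  "('a \<Rightarrow> nat) \<times> nat \<Rightarrow> 'a list \<Rightarrow> nat \<Rightarrow> nat \<Rightarrow> 'a list \<Rightarrow> (nat set \<times> nat) pmf" where
  "algorithm_B D P a b T = search random_match D P a b T 0 ()"

definition occurrences :: "'a list \<Rightarrow> 'a list \<Rightarrow> nat set" where
  "occurrences P T = {i. i + length P \<le> length T \<and> take (length P) (drop i T) = P}"

text \<open>Expectation over the random text and the random choices of the algorithm.\<close>

definition expected_time ::
  "'a set \<Rightarrow> nat \<Rightarrow> ('a list \<Rightarrow> (nat set \<times> nat) pmf) \<Rightarrow> real" where
  "expected_time \<Sigma> m alg =
     measure_pmf.expectation (replicate_pmf m (pmf_of_set \<Sigma>) \<bind> alg) (\<lambda>(R, t). real t)"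

lemma sparse_cands_iff:
  "(a, b) \<in> sparse_cands P u v \<longleftrightarrow>
     a \<in> set [1..<Suc b] \<and> b \<in> set [1..<Suc (length P)] \<and> ch P a = u \<and> ch P b = v \<and>
     (\<forall>k \<in> set [Suc a..<b]. ch P k \<noteq> u \<and> ch P k \<noteq> v)"
  by (auto simp: sparse_cands_def Suc_le_eq)

lemma is_sparseI:
  assumes "(a, b) \<in> sparse_cands P (ch P a) (ch P b)"
    and "\<forall>b' \<in> set [1..<Suc (length P)]. \<forall>a' \<in> set [1..<Suc b'].
           (\<forall>k \<in> set [Suc a'..<b']. ch P k \<noteq> ch P a' \<and> ch P k \<noteq> ch P b') \<longrightarrow>
           sublen a' b' < sublen a b \<or> sublen a' b' = sublen a b \<and> b' \<le> b"
  shows "is_sparse P a b"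
proof -
  have *: "sublen a' b' < sublen a b \<or> sublen a' b' = sublen a b \<and> b' \<le> b"
    if "(a', b') \<in> sparse_cands P u v" for a' b' u v
    using that assms(2) unfolding sparse_cands_iff by blast
  have "is_sparse_for P (ch P a) (ch P b) a b"
    using assms(1) * by (fastforce simp: is_sparse_for_def)
  then show ?thesis
    using * unfolding is_sparse_def by (metis is_sparse_for_def nat_less_le order_refl)
qed

lemma is_sparse_exists:
  assumes "P \<noteq> []"
  shows "\<exists>a b. is_sparse P a b"
proof -
  define S where "S = {(a, b). (a, b) \<in> sparse_cands P (ch P a) (ch P b)}"
  have sub: "S \<subseteq> {1..length P} \<times> {1..length P}"
    by (auto simp: S_def sparse_cands_def)
  have "(1, 1) \<in> S"
    using assms by (auto simp: S_def sparse_cands_def Suc_le_eq)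
  define f where "f = (\<lambda>(a, b). sublen a b * Suc (length P) + b)"
  have "finite (f ` S)" "f ` S \<noteq> {}"
    using \<open>(1, 1) \<in> S\<close> finite_subset[OF sub] by auto
  then have "Max (f ` S) \<in> f ` S" "\<And>y. y \<in> S \<Longrightarrow> f y \<le> Max (f ` S)"
    by simp_all
  then obtain x where x: "x \<in> S" "\<And>y. y \<in> S \<Longrightarrow> f y \<le> f x"
    by force
  obtain a b where ab: "x = (a, b)" by force
  have "is_sparse P a b"
  proof (rule is_sparseI)
    show "(a, b) \<in> sparse_cands P (ch P a) (ch P b)"
      using x(1) ab by (simp add: S_def)
    have "sublen a' b' < sublen a b \<or> sublen a' b' = sublen a b \<and> b' \<le> b"
      if "(a', b') \<in> S" for a' b'
    proof -
      have le: "sublen a' b' * Suc (length P) + b' \<le> sublen a b * Suc (length P) + b"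
        using x(2)[OF that] ab by (simp add: f_def)
      have "b \<le> length P" using x(1) sub ab by auto
      show ?thesis
      proof (rule ccontr)
        assume n: "\<not> ?thesis"
        then consider "sublen a b + 1 \<le> sublen a' b'" | "sublen a' b' = sublen a b" "b < b'"
          by linarith
        then show False
        proof cases
          case 1
          then have "(sublen a b + 1) * Suc (length P) \<le> sublen a' b' * Suc (length P)"
            by (rule mult_le_mono1)
          then show False using le \<open>b \<le> length P\<close> by simp
        qed (use le in simp)
      qed
    qed
    then show "\<forall>b' \<in> set [1..<Suc (length P)]. \<forall>a' \<in> set [1..<Suc b'].
           (\<forall>k \<in> set [Suc a'..<b']. ch P k \<noteq> ch P a' \<and> ch P k \<noteq> ch P b') \<longrightarrow>
           sublen a' b' < sublen a b \<or> sublen a' b' = sublen a b \<and> b' \<le> b"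
      unfolding S_def mem_Collect_eq prod.case sparse_cands_iff by blast
  qed
  then show ?thesis by blast
qed

lemma shift_in_sparse_pos:
  assumes "is_sparse P a b" and "c \<in> ch P ` {a..b}" and "c \<noteq> ch P b"
  shows "0 < shift_in_sparse P a b c"
proof -
  have "Max {k \<in> {a..b}. ch P k = c} \<in> {k \<in> {a..b}. ch P k = c}"
    using assms(2) by (intro Max_in) auto
  then show ?thesis
    using assms(3) unfolding shift_in_sparse_def by (metis (mono_tags, lifting) atLeastAtMost_iff le_neq_implies_less mem_Collect_eq zero_less_diff)
qed

lemma tables_pos:
  assumes "is_sparse P a b"
  shows "c \<noteq> ch P b \<Longrightarrow> 0 < stated_shift P a b c" "0 < stated_jump P a b"
    "c \<noteq> ch P b \<Longrightarrow> 0 < amended_shift P a b c" "0 < amended_jump P a b"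
proof -
  have "1 \<le> a" "a \<le> b" "b \<le> length P"
    using assms by (auto simp: is_sparse_def is_sparse_for_def sparse_cands_def)
  then show "c \<noteq> ch P b \<Longrightarrow> 0 < stated_shift P a b c" "0 < stated_jump P a b"
    "c \<noteq> ch P b \<Longrightarrow> 0 < amended_shift P a b c" "0 < amended_jump P a b"
    using shift_in_sparse_pos[OF assms]
    by (auto simp: stated_shift_def stated_jump_def amended_shift_def amended_jump_def sublen_def)
qed

lemma stated_jump_misses:
  defines "P \<equiv> [0, 0 :: nat]" and "T \<equiv> [0, 0, 0 :: nat]"
  shows "is_sparse P 1 2" and "1 \<in> occurrences P T"
    and "(R, t) \<in> set_pmf (search V (stated P 1 2) P 1 2 T 0 s) \<Longrightarrow> 1 \<notin> R"
proof -
  show "is_sparse P 1 2"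
    unfolding P_def by (rule is_sparseI; unfold sparse_cands_iff sublen_def; code_simp)
  show "1 \<in> occurrences P T"
    by (simp add: occurrences_def P_def T_def)
  show "(R, t) \<in> set_pmf (search V (stated P 1 2) P 1 2 T 0 s) \<Longrightarrow> 1 \<notin> R"
    by (subst (asm) search.simps) (auto simp: P_def T_def stated_def stated_jump_def sublen_def search_end split: if_splits)
qed

lemma stated_jump_misses':
  defines "P \<equiv> [0, 1 :: nat]" and "T \<equiv> [0, 1, 0, 1 :: nat]"
  shows "is_sparse P 1 2" and "2 \<in> occurrences P T"
    and "(R, t) \<in> set_pmf (search V (stated P 1 2) P 1 2 T 0 s) \<Longrightarrow> 2 \<notin> R"
proof -
  show "is_sparse P 1 2"
    unfolding P_def by (rule is_sparseI; unfold sparse_cands_iff sublen_def; code_simp)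
  show "2 \<in> occurrences P T"
    by (simp add: occurrences_def P_def T_def)
  show "(R, t) \<in> set_pmf (search V (stated P 1 2) P 1 2 T 0 s) \<Longrightarrow> 2 \<notin> R"
    by (subst (asm) search.simps) (auto simp: P_def T_def stated_def stated_jump_def sublen_def search_end split: if_splits)
qed

lemma stated_shift_misses:
  defines "P \<equiv> [0, 1, 2, 2 :: nat]" and "T \<equiv> [3, 3, 3, 0, 1, 2, 2 :: nat]"
  shows "is_sparse P 1 3" and "3 \<in> occurrences P T"
    and "search V (stated P 1 3) P 1 3 T 0 s = return_pmf ({}, 1)"
proof -
  show "is_sparse P 1 3"
    unfolding P_def by (rule is_sparseI; unfold sparse_cands_iff sublen_def; code_simp)
  show "3 \<in> occurrences P T"
    by (simp add: occurrences_def P_def T_def)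
  have "stated_shift P 1 3 3 = 4"
    by (auto simp: stated_shift_def P_def nth_Cons split: nat.splits)
  moreover have "ch T 3 = 3" "ch P 3 = 2" "length P = 4" "length T = 7"
    by (simp_all add: P_def T_def)
  ultimately show "search V (stated P 1 3) P 1 3 T 0 s = return_pmf ({}, 1)"
    by (subst search.simps) (simp add: stated_def search_end)
qed

lemma stated_shift_misses':
  defines "P \<equiv> [2, 0, 1, 1, 0 :: nat]" and "T \<equiv> [0, 0, 0, 0, 2, 0, 1, 1, 0 :: nat]"
  shows "is_sparse P 2 5" and "4 \<in> occurrences P T"
    and "search V (stated P 2 5) P 2 5 T 0 s = return_pmf ({}, 1)"
proof -
  show "is_sparse P 2 5"
    unfolding P_def by (rule is_sparseI; unfold sparse_cands_iff sublen_def; code_simp)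
  show "4 \<in> occurrences P T"
    by (simp add: occurrences_def P_def T_def)
  have "{2..5} = {2, 3, 4, 5::nat}" by auto
  then have "stated_shift P 2 5 2 = 5"
    by (simp add: stated_shift_def P_def sublen_def)
  moreover have "ch T 5 = 2" "ch P 5 = 0" "length P = 5" "length T = 9"
    by (simp_all add: P_def T_def)
  ultimately show "search V (stated P 2 5) P 2 5 T 0 s = return_pmf ({}, 1)"
    by (subst search.simps) (simp add: stated_def search_end)
qed

end

theory Submission
  imports Defs
begin

text \<open>
  A shortest substring of \<open>P\<close> that contains all its characters is a candidate for \<open>sparse(P)\<close>, hence
  \<open>|sparse(P)| \<ge> \<delta>\<close>.

  For the running time let \<open>q = min(|sparse(P)|, \<Delta>)\<close>.  The text character facing \<open>P[endpos(P)]\<close>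
  determines the displacement of the window and has not been read by the main loop before.  At most
  \<open>q / 4\<close> characters have a displacement of at most \<open>q / 4\<close>, so each round advances by a constant
  fraction of \<open>q\<close> on average and there are \<open>O(m / q)\<close> rounds.  The verifier is charged to all windows,
  visited or not: in a given window the text is uniformly distributed, the verifier is called only if
  the character facing \<open>P[endpos(P)]\<close> matches, and then it expects at most three comparisons in any
  fixed order if \<open>\<Delta> \<ge> 2\<close>; altogether \<open>O(m / \<Delta>)\<close>.  Apostolico--Giancarlo never takes more steps than the
  plain comparison from right to left.  For \<open>\<Delta> = 1\<close> its table \<open>M\<close> makes every call after the first one
  stop within three steps.
\<close>

section \<open>Sparse patterns\<close>

lemma is_sparseD:
  assumes "is_sparse P a b"
  shows "1 \<le> a" "a \<le> b" "b \<le> length P"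
    and "\<And>k. a < k \<Longrightarrow> k < b \<Longrightarrow> ch P k \<noteq> ch P a \<and> ch P k \<noteq> ch P b"
  using assms by (auto simp: is_sparse_def is_sparse_for_def sparse_cands_def)

text \<open>\<open>is_sparse\<close> is compared only with the best candidate of each pair
  \<open>(u, v)\<close>; this makes the comparison reach every candidate. The weight
  \<open>f\<close> encodes the order by length first and right end second as one number, since a
  right end is at most \<open>length P\<close>.\<close>

lemma is_sparse_for_exists:
  assumes "(x, y) \<in> sparse_cands P u v"
  obtains a b where "is_sparse_for P u v a b" "sublen x y \<le> sublen a b"
proof -
  define S where "S = sparse_cands P u v"
  define f where "f = (\<lambda>(a, b). sublen a b * Suc (length P) + b)"
  have sub: "S \<subseteq> {1..length P} \<times> {1..length P}"
    by (auto simp: S_def sparse_cands_def)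
  have "finite (f ` S)" "f ` S \<noteq> {}"
    using assms finite_subset[OF sub] by (auto simp: S_def)
  then have "Max (f ` S) \<in> f ` S" "\<And>z. z \<in> S \<Longrightarrow> f z \<le> Max (f ` S)"
    by simp_all
  then obtain a b where ab: "(a, b) \<in> S" "\<And>z. z \<in> S \<Longrightarrow> f z \<le> f (a, b)"
    by force
  have lex: "sublen a' b' < sublen a b \<or> sublen a' b' = sublen a b \<and> b' \<le> b"
    if "(a', b') \<in> S" for a' b'
  proof (rule ccontr)
    assume "\<not> ?thesis"
    then consider "sublen a b + 1 \<le> sublen a' b'" | "sublen a' b' = sublen a b" "b < b'"
      by linarith
    then show False
    proof cases
      case 1
      then have "(sublen a b + 1) * Suc (length P) \<le> sublen a' b' * Suc (length P)"
        by (rule mult_le_mono1)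
      moreover have "b \<le> length P" using ab(1) sub by auto
      ultimately show False using ab(2)[OF that] by (simp add: f_def)
    qed (use ab(2)[OF that] in \<open>simp add: f_def\<close>)
  qed
  have "is_sparse_for P u v a b"
    using ab(1) lex by (auto simp: is_sparse_for_def S_def)
  moreover have "sublen x y \<le> sublen a b"
    using lex[of x y] assms by (auto simp: S_def)
  ultimately show thesis by (rule that)
qed

lemma sparse_cands_sublen_le:
  assumes "is_sparse P a b" "(x, y) \<in> sparse_cands P u v"
  shows "sublen x y \<le> sublen a b"
proof -
  obtain a' b' where "is_sparse_for P u v a' b'" "sublen x y \<le> sublen a' b'"
    using assms(2) by (rule is_sparse_for_exists)
  then show ?thesis
    using assms(1) unfolding is_sparse_def by (meson le_trans)
qed

lemma ch_image_atLeastAtMost: "ch P ` {1..length P} = set P"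
proof -
  have "ch P ` Suc ` {..<length P} = (!) P ` {..<length P}"
    by (simp add: image_image)
  also have "Suc ` {..<length P} = {1..length P}"
    by (metis One_nat_def image_Suc_lessThan)
  finally show ?thesis by (auto simp: set_conv_nth)
qed

text \<open>In a shortest substring that contains all characters of \<open>P\<close>, neither end character recurs.\<close>

lemma card_set_le_sublen:
  assumes "is_sparse P a b"
  shows "card (set P) \<le> sublen a b"
proof -
  define Q where "Q = (\<lambda>(x, y). 1 \<le> x \<and> x \<le> y \<and> y \<le> length P \<and> ch P ` {x..y} = set P)"
  have "Q (1, length P)"
    using is_sparseD[OF assms] by (simp only: Q_def prod.case ch_image_atLeastAtMost) simp
  then obtain p where p: "Q p" "\<And>z. Q z \<Longrightarrow> sublen (fst p) (snd p) \<le> sublen (fst z) (snd z)"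
    using ex_has_least_nat[of Q "(1, length P)" "\<lambda>z. sublen (fst z) (snd z)"] by blast
  obtain x y where xy: "p = (x, y)" by force
  note Qxy = p(1)[unfolded xy Q_def prod.case]
  have min: "\<not> Q (x', y')" if "sublen x' y' < sublen x y" for x' y'
    using p(2)[of "(x', y')"] that xy by auto
  \<comment> \<open>If an end character recurred at \<open>k\<close>, that end could be dropped
    without losing a character of \<open>P\<close>, against minimality.\<close>
  have "ch P k \<noteq> ch P x \<and> ch P k \<noteq> ch P y" if k: "x < k" "k < y" for k
  proof (intro conjI notI)
    assume eq: "ch P k = ch P x"
    have "{x..y} = insert x {Suc x..y}" using k by auto
    moreover have "k \<in> {Suc x..y}" using k by simp
    then have "ch P x \<in> ch P ` {Suc x..y}" using eq by (metis imageI)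
    ultimately have "ch P ` {Suc x..y} = set P" using Qxy by (metis image_insert insert_absorb)
    then have "Q (Suc x, y)" using k Qxy by (simp add: Q_def)
    then show False using min[of "Suc x" y] k by (simp add: sublen_def)
  next
    assume eq: "ch P k = ch P y"
    have "{x..y} = insert y {x..y - 1}" "k \<in> {x..y - 1}" using k by auto
    moreover from this(2) have "ch P y \<in> ch P ` {x..y - 1}" using eq by (metis imageI)
    ultimately have "ch P ` {x..y - 1} = set P" using Qxy by (metis image_insert insert_absorb)
    then have "Q (x, y - 1)" using k Qxy by (auto simp: Q_def)
    moreover have "sublen x (y - 1) < sublen x y" using k by (simp add: sublen_def)
    ultimately show False using min by blast
  qed
  then have "(x, y) \<in> sparse_cands P (ch P x) (ch P y)"
    using Qxy by (simp add: sparse_cands_def)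
  then have "sublen x y \<le> sublen a b" by (rule sparse_cands_sublen_le[OF assms])
  moreover have "card (set P) \<le> sublen x y"
    using card_image_le[of "{x..y}" "ch P"] Qxy by (simp add: sublen_def)
  ultimately show ?thesis by linarith
qed

section \<open>Correctness of the main loop\<close>

lemma occurrences_iff:
  "i \<in> occurrences P T \<longleftrightarrow>
     i + length P \<le> length T \<and> (\<forall>k \<in> {1..length P}. ch P k = ch T (i + k))"
proof (cases "i + length P \<le> length T")
  case True
  have "take (length P) (drop i T) = P \<longleftrightarrow> (\<forall>k < length P. T ! (i + k) = P ! k)"
    using True by (simp add: list_eq_iff_nth_eq)
  also have "\<dots> \<longleftrightarrow> (\<forall>k \<in> Suc ` {..<length P}. ch P k = ch T (i + k))"
    by auto
  also have "Suc ` {..<length P} = {1..length P}"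
    by (metis One_nat_def image_Suc_lessThan)
  finally show ?thesis using True by (simp add: occurrences_def)
qed (simp add: occurrences_def)

text \<open>Type-2 and Type-3 events move by the same amount, so the displacement is a function of
  the single character facing \<open>P[b]\<close>. The \<open>max 1\<close> mirrors the one in
  \<open>search\<close>.\<close>

definition window_shift :: "('a \<Rightarrow> nat) \<times> nat \<Rightarrow> 'a list \<Rightarrow> nat \<Rightarrow> 'a \<Rightarrow> nat" where
  "window_shift D P b c = max 1 (if c = ch P b then snd D else fst D c)"

text \<open>\<open>I\<close> is an invariant of the persistent state: validity of the table
  \<open>M\<close> for Apostolico--Giancarlo, trivial for random comparison.\<close>

definition correct_verifier ::
  "('a, 's) verifier \<Rightarrow> 'a list \<Rightarrow> 'a list \<Rightarrow> ('s \<Rightarrow> bool) \<Rightarrow> bool" where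
  "correct_verifier V P T I \<longleftrightarrow>
     (\<forall>i s. I s \<and> i + length P \<le> length T \<longrightarrow>
        (\<forall>(found, t, s') \<in> set_pmf (V P T i s). (found \<longleftrightarrow> i \<in> occurrences P T) \<and> I s'))"

lemma correct_verifierD:
  assumes "correct_verifier V P T I" "I s" "i + length P \<le> length T"
    and "(found, t, s') \<in> set_pmf (V P T i s)"
  shows "found \<longleftrightarrow> i \<in> occurrences P T" "I s'"
  using assms unfolding correct_verifier_def by blast+

lemma set_pmf_searchE:
  assumes "(R, t) \<in> set_pmf (search V D P a b T i s)" "\<not> length T < i + length P"
  obtains (end_mismatch) t' where "ch T (i + b) \<noteq> ch P b"
      "(R, t') \<in> set_pmf (search V D P a b T (i + max 1 (fst D (ch T (i + b)))) s)" "t = t' + 1"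
    | (start_mismatch) t' where "ch T (i + b) = ch P b" "ch T (i + a) \<noteq> ch P a"
      "(R, t') \<in> set_pmf (search V D P a b T (i + max 1 (snd D)) s)" "t = t' + 2"
    | (verify) found t'' s' R' t' where "ch T (i + b) = ch P b"
      "(found, t'', s') \<in> set_pmf (V P T i s)"
      "(R', t') \<in> set_pmf (search V D P a b T (i + max 1 (snd D)) s')"
      "R = (if found then insert i R' else R')" "t = t' + 2 + t''"
proof -
  note unfolded = assms(1)[unfolded search.simps[of V D P a b T i s] if_not_P[OF assms(2)]]
  consider "ch T (i + b) \<noteq> ch P b" | "ch T (i + b) = ch P b" "ch T (i + a) \<noteq> ch P a"
    | "ch T (i + b) = ch P b" "ch T (i + a) = ch P a" by blast
  then show thesis
  proof cases
    case 1
    then show thesis using unfolded end_mismatch by auto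
  next
    case 2
    then show thesis using unfolded start_mismatch by auto
  next
    case 3
    then show thesis using unfolded verify by auto
  qed
qed

text \<open>An offset enters the result only after a positive answer of the verifier, so soundness
  holds for arbitrary tables \<open>D\<close>.\<close>

lemma search_sound:
  assumes V: "correct_verifier V P T I" and "I s"
    and "(R, t) \<in> set_pmf (search V D P a b T i s)"
  shows "R \<subseteq> occurrences P T"
  using assms(2,3)
proof (induction "Suc (length T) - i" arbitrary: i s R t rule: less_induct)
  case less
  show ?case
  proof (cases "length T < i + length P")
    case True
    then show ?thesis using less.prems by (simp add: search_end)
  next
    case False
    have IH: "R' \<subseteq> occurrences P T"
      if "I s'" "(R', t') \<in> set_pmf (search V D P a b T (i + max 1 d) s')" for s' R' t' d
      using less.hyps[OF _ that] False by simp
    from less.prems(2) False show ?thesis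
    proof (cases rule: set_pmf_searchE)
      case (verify found t'' s' R' t')
      have "found \<longleftrightarrow> i \<in> occurrences P T" "I s'"
        using correct_verifierD[OF V less.prems(1) _ verify(2)] False by simp_all
      then show ?thesis using IH[OF _ verify(3)] verify(4) by auto
    qed (use IH less.prems in blast)+
  qed
qed

text \<open>By \<open>safe\<close>, no occurrence starts strictly between two consecutive windows. A
  visited window rejected without verification has a mismatch at \<open>a\<close> or
  \<open>b\<close> and is no occurrence either.\<close>

lemma search_complete:
  assumes V: "correct_verifier V P T I" and "I s"
    and ab: "1 \<le> a" "a \<le> b" "b \<le> length P"
    and safe: "\<And>i j. i + length P \<le> length T \<Longrightarrow> i < j \<Longrightarrow>
                 j < i + window_shift D P b (ch T (i + b)) \<Longrightarrow> j \<notin> occurrences P T"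
    and "(R, t) \<in> set_pmf (search V D P a b T i s)"
  shows "occurrences P T \<inter> {i..} \<subseteq> R"
  using assms(2,7)
proof (induction "Suc (length T) - i" arbitrary: i s R t rule: less_induct)
  case less
  show ?case
  proof (cases "length T < i + length P")
    case True
    then show ?thesis by (auto simp: occurrences_def)
  next
    case False
    have IH: "occurrences P T \<inter> {i + max 1 d..} \<subseteq> R'"
      if "I s'" "(R', t') \<in> set_pmf (search V D P a b T (i + max 1 d) s')" for s' R' t' d
      using less.hyps[OF _ that] False by simp
    have step: "occurrences P T \<inter> {i..} \<subseteq> R'"
      if "occurrences P T \<inter> {i + max 1 d..} \<subseteq> R'" "i \<in> occurrences P T \<longrightarrow> i \<in> R'"
        "window_shift D P b (ch T (i + b)) = max 1 d" for R' d
    proof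
      fix j assume j: "j \<in> occurrences P T \<inter> {i..}"
      then consider "j = i" | "i < j" "j < i + max 1 d" | "j \<ge> i + max 1 d" by force
      then show "j \<in> R'"
        by cases (use that j safe[of i j] False in auto)
    qed
    from less.prems(2) False show ?thesis
    proof (cases rule: set_pmf_searchE)
      case 1: (end_mismatch t')
      have "i \<notin> occurrences P T"
        unfolding occurrences_iff using 1(1) ab by (auto intro!: bexI[of _ b])
      then show ?thesis
        using 1(1) by (intro step[OF IH[OF less.prems(1) 1(2)]]) (auto simp: window_shift_def)
    next
      case 2: (start_mismatch t')
      have "i \<notin> occurrences P T"
        unfolding occurrences_iff using 2(2) ab by (auto intro!: bexI[of _ a])
      then show ?thesis
        using 2(1) by (intro step[OF IH[OF less.prems(1) 2(3)]]) (auto simp: window_shift_def)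
    next
      case 3: (verify found t'' s' R' t')
      have "found \<longleftrightarrow> i \<in> occurrences P T" "I s'"
        using correct_verifierD[OF V less.prems(1) _ 3(2)] False by simp_all
      then show ?thesis using IH[OF _ 3(3)] 3(1,4)
        by (intro step[of "snd D"]) (auto simp: window_shift_def)
    qed
  qed
qed

text \<open>An occurrence at \<open>i + s\<close> with \<open>s < b\<close> puts
  \<open>P[b - s]\<close> on the text position \<open>i + b\<close>, hence
  \<open>P[b - s] = c\<close>. Each amended displacement is so small that every \<open>s\<close>
  below it contradicts this.\<close>

lemma amended_shift_safe:
  assumes sp: "is_sparse P a b" and i: "i + length P \<le> length T"
    and j: "i < j" "j < i + window_shift (amended P a b) P b (ch T (i + b))"
  shows "j \<notin> occurrences P T"
proof
  assume occ: "j \<in> occurrences P T"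
  note sp' = is_sparseD[OF sp]
  define c where "c = ch T (i + b)"
  define s where "s = j - i"
  have js: "j = i + s" "0 < s" using j by (auto simp: s_def)
  have PT: "ch P (b - s) = c" if "s < b"
  proof -
    have "b - s \<in> {1..length P}" using that sp' by auto
    then have "ch P (b - s) = ch T (j + (b - s))" using occ unfolding occurrences_iff by blast
    moreover have "j + (b - s) = i + b" using js that by simp
    ultimately show ?thesis by (simp add: c_def)
  qed
  have less: "s < window_shift (amended P a b) P b c" using j js by (simp add: c_def)
  show False
  proof (cases "c = ch P b")
    case True
    with less have s: "s < amended_jump P a b"
      using js by (auto simp: window_shift_def amended_def)
    \<comment> \<open>Since \<open>0 < s\<close>, the \<open>max 1\<close> of
      \<open>amended_jump\<close> allows no further value of \<open>s\<close>.\<close>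
    have "s < b - a \<or> s = b - a \<and> ch P a \<noteq> ch P b"
      using s js by (auto simp: amended_jump_def split: if_splits)
    then show False
    proof
      assume "s < b - a"
      then have "a < b - s" "b - s < b" "s < b" using js(2) sp'(1,2) by linarith+
      then show False using sp'(4)[of "b - s"] PT True by blast
    next
      assume "s = b - a \<and> ch P a \<noteq> ch P b"
      moreover from this have "b - s = a" "s < b" using sp'(1,2) by linarith+
      ultimately show False using PT True by auto
    qed
  next
    case False
    with less have s: "s < amended_shift P a b c"
      using js by (auto simp: window_shift_def amended_def)
    consider "c \<in> ch P ` {a..b}" | "c \<notin> ch P ` {a..b}" "c \<notin> set P"
      | "c \<notin> ch P ` {a..b}" "c \<in> set P" by blast
    then show False
    proof cases
      case 1
      then have "Max {k \<in> {a..b}. ch P k = c} \<in> {k \<in> {a..b}. ch P k = c}"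
        by (intro Max_in) auto
      then have m: "a \<le> Max {k \<in> {a..b}. ch P k = c}" "Max {k \<in> {a..b}. ch P k = c} \<le> b" by auto
      have "s < b - Max {k \<in> {a..b}. ch P k = c}"
        using s 1 by (simp add: amended_shift_def shift_in_sparse_def)
      moreover from this have "b - s \<in> {k \<in> {a..b}. ch P k = c}" using PT m by auto
      then have "b - s \<le> Max {k \<in> {a..b}. ch P k = c}" by (intro Max_ge) auto
      ultimately show False by linarith
    next
      case 2
      then have "s < b" using s by (simp add: amended_shift_def)
      moreover have "ch P (b - s) \<in> set P" using sp' \<open>s < b\<close> by (intro nth_mem) auto
      ultimately show False using PT 2 by simp
    next
      case 3
      then have "s \<le> b - a" using s by (simp add: amended_shift_def)
      then have "b - s \<in> {a..b}" "s < b" using sp'(1,2) by auto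
      then show False using PT 3(1) by blast
    qed
  qed
qed

section \<open>The Apostolico--Giancarlo verifier\<close>

lemma suffix_iff_nth:
  "suffix w xs \<longleftrightarrow> length w \<le> length xs \<and>
     (\<forall>r < length w. w ! (length w - Suc r) = xs ! (length xs - Suc r))"
proof -
  have "suffix w xs \<longleftrightarrow> prefix (rev w) (rev xs)" by (simp add: suffix_to_prefix)
  also have "\<dots> \<longleftrightarrow> length w \<le> length xs \<and> rev w = take (length w) (rev xs)"
    by (metis append_eq_conv_conj length_rev prefix_def prefix_length_le take_is_prefix)
  also have "\<dots> \<longleftrightarrow> length w \<le> length xs \<and>
     (\<forall>r < length w. w ! (length w - Suc r) = xs ! (length xs - Suc r))"
    by (auto simp: list_eq_iff_nth_eq rev_nth)
  finally show ?thesis .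
qed

lemma suffix_len_eq:
  assumes "k \<le> length P"
  shows "suffix_len P k = Max {l. l \<le> k \<and> (\<forall>r < l. ch P (k - r) = ch P (length P - r))}"
proof -
  have "(\<exists>w. l = length w \<and> suffix w (take k P) \<and> suffix w P) \<longleftrightarrow>
        l \<le> k \<and> (\<forall>r < l. ch P (k - r) = ch P (length P - r))" for l
  proof
    assume "\<exists>w. l = length w \<and> suffix w (take k P) \<and> suffix w P"
    then obtain w where w: "l = length w" "suffix w (take k P)" "suffix w P" by blast
    show "l \<le> k \<and> (\<forall>r < l. ch P (k - r) = ch P (length P - r))"
      using w assms unfolding suffix_iff_nth by auto
  next
    assume *: "l \<le> k \<and> (\<forall>r < l. ch P (k - r) = ch P (length P - r))"
    define w where "w = drop (length P - l) P"
    have "length w = l" "suffix w P" using * assms by (auto simp: w_def suffix_drop)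
    moreover have "suffix w (take k P)"
      unfolding suffix_iff_nth using * assms \<open>length w = l\<close> by (auto simp: w_def)
    ultimately show "\<exists>w. l = length w \<and> suffix w (take k P) \<and> suffix w P" by blast
  qed
  then show ?thesis unfolding suffix_len_def by simp
qed

text \<open>The maximum is attained, which gives the matches; if the next pair to the left also
  matched, the length could be increased by one.\<close>

lemma suffix_len:
  assumes "k \<le> length P"
  shows suffix_len_le: "suffix_len P k \<le> k"
    and suffix_len_match: "r < suffix_len P k \<Longrightarrow> ch P (k - r) = ch P (length P - r)"
    and suffix_len_mismatch: "suffix_len P k < k \<Longrightarrow>
          ch P (k - suffix_len P k) \<noteq> ch P (length P - suffix_len P k)"
proof -
  define S where "S = {l. l \<le> k \<and> (\<forall>r < l. ch P (k - r) = ch P (length P - r))}"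
  have N: "suffix_len P k = Max S" using suffix_len_eq[OF assms] by (simp add: S_def)
  have fin: "finite S" by (rule finite_subset[of _ "{..k}"]) (auto simp: S_def)
  have "0 \<in> S" by (simp add: S_def)
  then have in_S: "Max S \<in> S" using fin by (intro Max_in) auto
  then show "suffix_len P k \<le> k" "r < suffix_len P k \<Longrightarrow> ch P (k - r) = ch P (length P - r)"
    by (auto simp: N S_def)
  assume lt: "suffix_len P k < k"
  show "ch P (k - suffix_len P k) \<noteq> ch P (length P - suffix_len P k)"
  proof
    assume "ch P (k - suffix_len P k) = ch P (length P - suffix_len P k)"
    then have "Suc (Max S) \<in> S" using in_S lt unfolding N by (auto simp: S_def less_Suc_eq)
    then have "Suc (Max S) \<le> Max S" using fin by (rule Max_ge[rotated])
    then show False by simp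
  qed
qed

text \<open>The two bounds keep the subtractions \<open>j - r\<close> and
  \<open>length P - r\<close> from being truncated at 0.\<close>

definition memo_valid :: "'a list \<Rightarrow> 'a list \<Rightarrow> (nat \<Rightarrow> nat) \<Rightarrow> bool" where
  "memo_valid P T M \<longleftrightarrow>
     (\<forall>j. M j \<le> length P \<and> M j \<le> j \<and> (\<forall>r < M j. ch T (j - r) = ch P (length P - r)))"

lemma match_in_order_le: "snd (match_in_order P T i ks) \<le> length ks"
  by (induction ks) (auto split: prod.splits)

lemma fst_match_in_order:
  "fst (match_in_order P T i ks) \<longleftrightarrow> (\<forall>k \<in> set ks. ch P k = ch T (i + k))"
  by (induction ks) (auto split: prod.splits)

text \<open>Plain comparison from right to left pays \<open>d\<close> steps for \<open>d\<close>
  matching positions; a jump of the scan over them is charged against these.\<close>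

lemma match_in_order_rev_skip:
  assumes "d \<le> k" "\<And>r. k - d < r \<Longrightarrow> r \<le> k \<Longrightarrow> ch P r = ch T (i + r)"
  shows "snd (match_in_order P T i (rev [1..<Suc k])) =
         d + snd (match_in_order P T i (rev [1..<Suc (k - d)]))"
  using assms
proof (induction d arbitrary: k)
  case (Suc d)
  then obtain k' where k: "k = Suc k'" by (cases k) auto
  have "snd (match_in_order P T i (rev [1..<Suc k])) =
        Suc (snd (match_in_order P T i (rev [1..<Suc k'])))"
    using Suc.prems(2)[of k] k by (simp split: prod.splits)
  also have "snd (match_in_order P T i (rev [1..<Suc k'])) =
        d + snd (match_in_order P T i (rev [1..<Suc (k' - d)]))"
    using Suc.prems k by (intro Suc.IH) auto
  finally show ?case using k by simp
qed simp

lemma match_in_order_rev_pos: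
  "0 < k \<Longrightarrow> 1 \<le> snd (match_in_order P T i (rev [1..<Suc k]))"
  by (cases k) (auto split: prod.splits)

text \<open>At position \<open>k\<close>, \<open>m = M (i + k)\<close> tells how far the text agrees
  with the end of \<open>P\<close>, and \<open>N = suffix_len P k\<close> how far
  \<open>P[1..k]\<close> does. If \<open>m\<close> is the smaller, or both are equal and below
  \<open>k\<close>, the next \<open>m\<close> pairs match and are skipped. If
  \<open>N = k \<le> m\<close>, the rest of the window matches. If \<open>N < m\<close> and
  \<open>N < k\<close>, the pair at \<open>k - N\<close> is a mismatch. Each iteration costs one
  step and replaces at least one plain comparison.\<close>

lemma ag_scan_correct:
  assumes M: "memo_valid P T M"
    and "k \<le> length P"
    and "\<And>r. k < r \<Longrightarrow> r \<le> length P \<Longrightarrow> ch P r = ch T (i + r)"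
    and "ag_scan P T M i k = (found, t, l)"
  shows "(found \<longleftrightarrow> (\<forall>r \<in> {1..length P}. ch P r = ch T (i + r))) \<and> (found \<longrightarrow> l = length P) \<and>
         t \<le> snd (match_in_order P T i (rev [1..<Suc k])) \<and>
         l \<le> length P \<and> (\<forall>r < l. ch T (i + length P - r) = ch P (length P - r))"
  using assms(2-)
proof (induction k arbitrary: found t l rule: less_induct)
  case (less k)
  let ?n = "length P"
  let ?cost = "\<lambda>k. snd (match_in_order P T i (rev [1..<Suc k]))"
  let ?N = "suffix_len P k"
  define m where "m = M (i + k)"
  note known = less.prems(2)
  note scan = less.prems(3)[unfolded ag_scan.simps[of P T M i k], folded m_def]
  have tail: "ch T (i + ?n - r) = ch P (?n - r)" if "r < ?n - k" for r
    using known[of "?n - r"] that by simp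
  have Mk: "m \<le> i + k" "r < m \<Longrightarrow> ch T (i + k - r) = ch P (?n - r)" for r
    using M by (auto simp: memo_valid_def m_def)
  note N = suffix_len[OF less.prems(1)]
  \<comment> \<open>Common to a single matching comparison (\<open>d = 1\<close>) and a jump by the
    table (\<open>d = m\<close>); the one step spent is at most \<open>d\<close>.\<close>
  have skip: ?case if "0 < d" "d \<le> k" "\<And>r. r < d \<Longrightarrow> ch P (k - r) = ch T (i + k - r)"
    "ag_scan P T M i (k - d) = (found, t', l)" "t = t' + 1" for d t'
  proof -
    have match: "ch P r = ch T (i + r)" if "k - d < r" "r \<le> k" for r
      using \<open>\<And>r. r < d \<Longrightarrow> ch P (k - r) = ch T (i + k - r)\<close>[of "k - r"] that by simp
    have "?cost k = d + ?cost (k - d)" (is "?x = d + ?y")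
      by (rule match_in_order_rev_skip) (use that match in auto)
    moreover have "ch P r = ch T (i + r)" if "k - d < r" "r \<le> ?n" for r
      using match known that by (cases "r \<le> k") auto
    ultimately show ?thesis
      using less.IH[OF _ _ _ that(4)] that(1,2,5) less.prems(1) add_le_mono[of 1 d t' ?y]
      by (auto simp del: upt_Suc)
  qed
  have fail: ?case if "\<not> found" "t = 1" "r \<in> {1..k}" "ch P r \<noteq> ch T (i + r)" "l \<le> ?n"
    "\<forall>r < l. ch T (i + ?n - r) = ch P (?n - r)" for r
  proof -
    have "r \<in> {1..?n}" "0 < k" using that(3) less.prems(1) by auto
    then show ?thesis using that match_in_order_rev_pos[of k P T i] by blast
  qed
  consider "k = 0" | "k > 0" "m = 0" "ch P k = ch T (i + k)"
    | "k > 0" "m = 0" "ch P k \<noteq> ch T (i + k)"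
    | "k > 0" "m > 0" "m < ?N \<or> m = ?N \<and> ?N < k"
    | "k > 0" "m > 0" "?N \<le> m" "?N = k"
    | "k > 0" "m > 0" "?N < m" "?N < k"
    using N(1) by force
  then show ?case
  proof cases
    case 1
    have all: "\<forall>r \<in> {1..?n}. ch P r = ch T (i + r)" using known 1 by auto
    have "found" "t = 0" "l = ?n" using scan 1 by auto
    moreover have "\<forall>r < ?n. ch T (i + ?n - r) = ch P (?n - r)" using tail 1 by auto
    ultimately show ?thesis using all by simp
  next
    case 2
    then obtain t' where "ag_scan P T M i (k - 1) = (found, t', l)" "t = t' + 1"
      using scan by (auto split: prod.splits)
    then show ?thesis using 2 by (intro skip[of 1]) auto
  next
    case 3
    then have "\<not> found" "t = 1" "l = ?n - k"
      using scan by auto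
    then show ?thesis using 3 tail by (intro fail[of k]) auto
  next
    case 4
    then obtain t' where t': "ag_scan P T M i (k - m) = (found, t', l)" "t = t' + 1"
      using scan by (auto split: prod.splits)
    have "ch P (k - r) = ch T (i + k - r)" if "r < m" for r
      using Mk(2)[of r] N(2)[of r] 4 that by auto
    then show ?thesis using 4 t' N(1) by (intro skip[of m]) auto
  next
    case 5
    then have "found" "t = 1" "l = ?n"
      using scan by auto
    have "ch P r = ch T (i + r)" if "1 \<le> r" "r \<le> k" for r
      using Mk(2)[of "k - r"] N(2)[of "k - r"] 5 that by auto
    then have all: "\<forall>r \<in> {1..?n}. ch P r = ch T (i + r)"
      using known by (metis atLeastAtMost_iff not_less)
    have "ch T (i + ?n - r) = ch P (?n - r)" if "r < ?n" for r
      using all[rule_format, of "?n - r"] that by simp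
    then show ?thesis
      using all \<open>found\<close> \<open>t = 1\<close> \<open>l = ?n\<close> match_in_order_rev_pos[OF 5(1), of P T i] by simp
  next
    case 6
    then have res: "\<not> found" "t = 1" "l = ?n - k + ?N"
      using scan by auto
    have "ch T (i + ?n - r) = ch P (?n - r)" if "r < l" for r
    proof (cases "r < ?n - k")
      case False
      \<comment> \<open>Beyond the part already scanned, the new entry is justified by combining the
        old entry at \<open>i + k\<close> with \<open>N\<close>; \<open>r'\<close> counts from
        position \<open>k\<close>.\<close>
      define r' where "r' = r - (?n - k)"
      have "r' < ?N" "i + ?n - r = i + k - r'" "?n - r = k - r'"
        using False that res(3) less.prems(1) by (auto simp: r'_def)
      then show ?thesis using Mk(2)[of r'] N(2)[of r'] 6 by simp
    qed (use tail in auto)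
    \<comment> \<open>As \<open>?N < m\<close>, the text here carries \<open>P[n - N]\<close>, which
      differs from \<open>P[k - N]\<close> by maximality of \<open>N\<close>.\<close>
    moreover have "ch P (k - ?N) \<noteq> ch T (i + (k - ?N))"
      using Mk(2)[of ?N] N(3) 6 by auto
    ultimately show ?thesis
      using res 6 N(1) less.prems(1) by (intro fail[of "k - ?N"]) auto
  qed
qed

text \<open>The last bound does not involve \<open>M\<close>, so the expected cost can be computed
  without knowing the distribution of the table.\<close>

lemma apostolico_giancarlo_result:
  assumes "memo_valid P T M" and "i + length P \<le> length T"
    and "(found, t, M') \<in> set_pmf (apostolico_giancarlo P T i M)"
  shows "found \<longleftrightarrow> i \<in> occurrences P T" "memo_valid P T M'"
    "t \<le> snd (match_in_order P T i (rev [1..<Suc (length P)]))"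
proof -
  obtain l where l: "ag_scan P T M i (length P) = (found, t, l)" "M' = M(i + length P := l)"
    using assms(3) by (auto simp: apostolico_giancarlo_def split: prod.splits)
  note * = ag_scan_correct[OF assms(1) _ _ l(1)]
  show "found \<longleftrightarrow> i \<in> occurrences P T" "memo_valid P T M'"
    "t \<le> snd (match_in_order P T i (rev [1..<Suc (length P)]))"
    using * assms(1,2) by (auto simp: occurrences_iff memo_valid_def l(2))
qed

lemma correct_verifier_apostolico_giancarlo:
  "correct_verifier apostolico_giancarlo P T (memo_valid P T)"
  using apostolico_giancarlo_result unfolding correct_verifier_def by blast

text \<open>The answer depends only on the set of compared positions, and this is
  \<open>{1..n}\<close> for every permutation.\<close>

lemma correct_verifier_random_match: "correct_verifier random_match P T (\<lambda>_. True)"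
proof -
  have "found \<longleftrightarrow> i \<in> occurrences P T"
    if res: "(found, t, s') \<in> set_pmf (random_match P T i s)" and i: "i + length P \<le> length T"
    for found t s' i s
  proof -
    have "\<exists>ks \<in> permutations_of_set {1..length P}. found = fst (match_in_order P T i ks)"
      using res unfolding random_match_def set_bind_pmf
      by (subst (asm) set_pmf_of_set) (auto simp: case_prod_beta intro!: bexI)
    then obtain ks where "ks \<in> permutations_of_set {1..length P}"
        "found = fst (match_in_order P T i ks)" ..
    then show ?thesis
      using i fst_match_in_order[of P T i ks]
      by (simp add: occurrences_iff permutations_of_setD)
  qed
  then show ?thesis unfolding correct_verifier_def by blast
qed

section \<open>Decomposition of the running time\<close>

text \<open>
  The main loop, seen through the characters that face \<open>P[endpos(P)]\<close>: \<open>xs\<close> is the text from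
  that character on, \<open>k = n - endpos(P)\<close>, and \<open>\<sigma>\<close> is the displacement of the window.
  Only the first character of \<open>xs\<close> is inspected before the rest is reached, so that for random
  \<open>xs\<close> the displacements are independent.
\<close>

function rounds :: "('a \<Rightarrow> nat) \<Rightarrow> nat \<Rightarrow> 'a list \<Rightarrow> nat" where
  "rounds \<sigma> k xs =
     (if length xs \<le> k then 0 else Suc (rounds \<sigma> k (drop (max 1 (\<sigma> (hd xs))) xs)))"
  by pat_completeness auto
termination
  by (relation "Wellfounded.measure (\<lambda>(\<sigma>, k, xs). length xs)") auto

declare rounds.simps [simp del]

text \<open>The text is fixed here and only the verifier is random. A round reads at most two
  characters; charging \<open>w j\<close> to every window whose character at \<open>b\<close>
  matches removes the dependence on which windows are visited.\<close>

lemma nn_integral_search_le: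
  fixes w :: "nat \<Rightarrow> ennreal"
  assumes V: "correct_verifier V P T I" and "I s"
    and b: "1 \<le> b" "b \<le> length P"
    and cost: "\<And>j s. I s \<Longrightarrow> j + length P \<le> length T \<Longrightarrow>
                 (\<integral>\<^sup>+ x. of_nat (fst (snd x)) \<partial>measure_pmf (V P T j s)) \<le> w j"
  shows "(\<integral>\<^sup>+ x. of_nat (snd x) \<partial>measure_pmf (search V D P a b T i s)) \<le>
           2 * of_nat (rounds (window_shift D P b) (length P - b) (drop (i + b - 1) T)) +
           (\<Sum>j = i..<Suc (length T) - length P. if ch T (j + b) = ch P b then w j else 0)"
    (is "?I i s \<le> 2 * of_nat (?r i) + (\<Sum>j = i..<?e. ?w j)")
  using assms(2)
proof (induction "Suc (length T) - i" arbitrary: i s rule: less_induct)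
  case less
  show ?case
  proof (cases "length T < i + length P")
    case True
    then show ?thesis by (simp add: search_end)
  next
    case False
    then have i: "i + length P \<le> length T" by simp
    define d where "d = window_shift D P b (ch T (i + b))"
    have "d \<ge> 1" by (simp add: d_def window_shift_def)
    have "i < ?e" using i by simp
    have hd: "hd (drop (i + b - 1) T) = ch T (i + b)"
      using i b by (intro hd_drop_conv_nth) linarith
    have "?r i = Suc (?r (i + d))"
    proof -
      have "drop (max 1 d) (drop (i + b - 1) T) = drop (i + d + b - 1) T"
        using \<open>d \<ge> 1\<close> b by (simp add: add.commute add.left_commute)
      moreover have "\<not> length (drop (i + b - 1) T) \<le> length P - b" using i b by auto
      ultimately show ?thesis by (subst rounds.simps) (simp only: hd d_def if_False)
    qed
    then have r: "2 * of_nat (?r i) = 2 + 2 * (of_nat (?r (i + d)) :: ennreal)"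
      by (simp add: distrib_left)
    \<comment> \<open>The windows skipped by the displacement only add nonnegative terms.\<close>
    have sums: "?w i + (\<Sum>j = i + d..<?e. ?w j) \<le> (\<Sum>j = i..<?e. ?w j)"
    proof -
      have "?w i + (\<Sum>j = i + d..<?e. ?w j) = (\<Sum>j \<in> insert i {i + d..<?e}. ?w j)"
        using \<open>d \<ge> 1\<close> by (subst sum.insert) auto
      also have "\<dots> \<le> (\<Sum>j = i..<?e. ?w j)"
        using \<open>i < ?e\<close> by (intro sum_mono2) auto
      finally show ?thesis .
    qed
    have IH: "?I (i + d) s' \<le> 2 * of_nat (?r (i + d)) + (\<Sum>j = i + d..<?e. ?w j)" if "I s'" for s'
      using less.hyps[OF _ that] \<open>d \<ge> 1\<close> i by simp
    note unf = search.simps[of V D P a b T i s, unfolded if_not_P[OF False]]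
    have step: ?thesis if "?I i s \<le> 2 + ?w i + (2 * of_nat (?r (i + d)) + (\<Sum>j = i + d..<?e. ?w j))"
    proof -
      have "?I i s \<le> 2 + 2 * of_nat (?r (i + d)) + (?w i + (\<Sum>j = i + d..<?e. ?w j))"
        using that by (simp add: ac_simps)
      also have "\<dots> \<le> 2 + 2 * of_nat (?r (i + d)) + (\<Sum>j = i..<?e. ?w j)"
        by (intro add_left_mono sums)
      finally show ?thesis by (simp only: r)
    qed
    consider "ch T (i + b) \<noteq> ch P b" | "ch T (i + b) = ch P b" "ch T (i + a) \<noteq> ch P a"
      | "ch T (i + b) = ch P b" "ch T (i + a) = ch P a" by blast
    then show ?thesis
    proof cases
      case 1
      then have "search V D P a b T i s = map_pmf (\<lambda>(R, t). (R, t + 1)) (search V D P a b T (i + d) s)"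
        by (simp add: unf d_def window_shift_def)
      then have "?I i s = ?I (i + d) s + 1"
        by (simp add: case_prod_beta nn_integral_add)
      also have "\<dots> \<le> 2 + ?I (i + d) s" by (subst add.commute) (intro add_right_mono, simp)
      also have "\<dots> \<le> 2 + (2 * of_nat (?r (i + d)) + (\<Sum>j = i + d..<?e. ?w j))"
        by (intro add_left_mono IH less.prems)
      finally show ?thesis using 1 by (intro step) simp
    next
      case 2
      then have "search V D P a b T i s = map_pmf (\<lambda>(R, t). (R, t + 2)) (search V D P a b T (i + d) s)"
        by (simp add: unf d_def window_shift_def)
      then have "?I i s = ?I (i + d) s + 2"
        by (simp add: case_prod_beta nn_integral_add)
      also have "\<dots> \<le> 2 + ?w i + (2 * of_nat (?r (i + d)) + (\<Sum>j = i + d..<?e. ?w j))"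
        by (subst add.commute) (intro add_mono IH less.prems, simp)
      finally show ?thesis by (rule step)
    next
      case 3
      let ?B = "2 * of_nat (?r (i + d)) + (\<Sum>j = i + d..<?e. ?w j)"
      have "search V D P a b T i s = V P T i s \<bind> (\<lambda>(found, t', s').
          map_pmf (\<lambda>(R, t). (if found then insert i R else R, t + 2 + t'))
            (search V D P a b T (i + d) s'))"
        using 3 by (simp add: unf d_def window_shift_def)
      then have "?I i s = (\<integral>\<^sup>+ x. (?I (i + d) (snd (snd x)) + 2 + of_nat (fst (snd x)))
          \<partial>measure_pmf (V P T i s))"
        by (simp add: case_prod_beta nn_integral_add)
      also have "\<dots> \<le> (\<integral>\<^sup>+ x. (?B + 2 + of_nat (fst (snd x))) \<partial>measure_pmf (V P T i s))"
      proof (intro nn_integral_mono_AE, subst AE_measure_pmf_iff, intro ballI add_right_mono)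
        fix x assume x: "x \<in> set_pmf (V P T i s)"
        then have "(fst x, fst (snd x), snd (snd x)) \<in> set_pmf (V P T i s)" by simp
        from correct_verifierD(2)[OF V less.prems i this] show "?I (i + d) (snd (snd x)) \<le> ?B"
          by (rule IH)
      qed
      also have "\<dots> = ?B + 2 + (\<integral>\<^sup>+ x. of_nat (fst (snd x)) \<partial>measure_pmf (V P T i s))"
        by (simp add: nn_integral_add)
      also have "\<dots> \<le> ?B + 2 + w i" by (intro add_left_mono cost less.prems i)
      also have "\<dots> = 2 + ?w i + ?B" using 3 by (simp add: ac_simps)
      finally show ?thesis by (rule step)
    qed
  qed
qed

section \<open>The number of rounds\<close>

text \<open>After a displacement the unread text is again a random text, which lets the count of
  rounds be bounded by induction on its length.\<close>

lemma map_drop_replicate_pmf: "map_pmf (drop k) (replicate_pmf m p) = replicate_pmf (m - k) p"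
proof (induction m arbitrary: k)
  case (Suc m)
  show ?case
  proof (cases k)
    case 0
    then show ?thesis by (simp add: drop_0[abs_def] id_def[symmetric] pmf.map_id del: replicate_pmf.simps)
  next
    case (Suc k')
    then show ?thesis using Suc.IH[of k']
      by (simp add: map_bind_pmf map_pmf_def[symmetric] pmf.map_comp o_def)
  qed
qed simp

lemma nn_integral_replicate_pmf_Suc:
  "(\<integral>\<^sup>+ xs. f xs \<partial>measure_pmf (replicate_pmf (Suc m) p)) =
   (\<integral>\<^sup>+ x. (\<integral>\<^sup>+ xs. f (x # xs) \<partial>measure_pmf (replicate_pmf m p)) \<partial>measure_pmf p)"
  by simp

text \<open>
  A drift argument: the potential \<open>r + q\<close>, where \<open>r\<close> is the number of remaining window positions,
  decreases by at least \<open>3 q / 16\<close> on average; the summand \<open>q\<close> pays for the last displacement,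
  which may overshoot.
\<close>

lemma nn_integral_rounds_le:
  fixes \<Sigma> :: "'a set" and q :: nat
  assumes \<Sigma>: "finite \<Sigma>" "\<Sigma> \<noteq> {}" and q: "0 < q"
    and rare: "4 * card {c \<in> \<Sigma>. \<sigma> c \<le> q div 4} \<le> card \<Sigma>"
  shows "(\<integral>\<^sup>+ xs. of_nat (rounds \<sigma> k xs) \<partial>measure_pmf (replicate_pmf l (pmf_of_set \<Sigma>))) \<le>
           ennreal (16 / (3 * real q) * (real (l - k) + real q))"
proof (induction l rule: less_induct)
  case (less l)
  let ?p = "pmf_of_set \<Sigma>"
  let ?G = "\<lambda>l. \<integral>\<^sup>+ xs. of_nat (rounds \<sigma> k xs) \<partial>measure_pmf (replicate_pmf l ?p)"
  \<comment> \<open>The reciprocal of the drift \<open>3 q / 16\<close>: the expected number of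
    rounds per unit of potential.\<close>
  define \<alpha> where "\<alpha> = 16 / (3 * real q)"
  have "\<alpha> > 0" using q by (simp add: \<alpha>_def)
  have zero: "?G l = 0" if "l \<le> k" for l
  proof -
    have "?G l = (\<integral>\<^sup>+ xs. 0 \<partial>measure_pmf (replicate_pmf l ?p))"
      using that by (intro nn_integral_cong_AE)
        (auto simp: AE_measure_pmf_iff set_replicate_pmf rounds.simps)
    then show ?thesis by simp
  qed
  show ?case
  proof (cases "l \<le> k")
    case True
    then show ?thesis using zero by simp
  next
    case False
    then obtain l' where l': "l = Suc l'" by (cases l) auto
    define B where "B = {c \<in> \<Sigma>. \<sigma> c \<le> q div 4}"
    \<comment> \<open>Bound on the rounds left after reading \<open>c\<close>. Outside
      \<open>B\<close> the displacement exceeds \<open>q div 4\<close>, hence is at least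
      \<open>q / 4\<close>; inside \<open>B\<close> no progress is credited.\<close>
    define f where "f c = \<alpha> * (real (l - k) + real q - (if c \<in> B then 0 else real q / 4))" for c
    have f_nonneg: "0 \<le> f c" for c
      unfolding f_def using \<open>\<alpha> > 0\<close> by (intro mult_nonneg_nonneg) auto
    have bound: "?G (l - max 1 (\<sigma> c)) \<le> ennreal (f c)" if "c \<in> \<Sigma>" for c
    \<comment> \<open>If the text is exhausted, no rounds remain and \<open>f c\<close> is
      nonnegative thanks to the summand \<open>q\<close>; otherwise the subtraction is not
      truncated.\<close>
    proof (cases "l - max 1 (\<sigma> c) \<le> k")
      case True
      then show ?thesis by (subst zero) auto
    next
      case far: False
      have "?G (l - max 1 (\<sigma> c)) \<le> ennreal (\<alpha> * (real (l - max 1 (\<sigma> c) - k) + real q))"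
        unfolding \<alpha>_def using False by (intro less.IH) auto
      also have "\<dots> \<le> ennreal (f c)"
        unfolding f_def using \<open>\<alpha> > 0\<close> far that
        by (intro ennreal_leI mult_left_mono) (auto simp: B_def)
      finally show ?thesis .
    qed
    have unroll: "rounds \<sigma> k (c # xs) = Suc (rounds \<sigma> k (drop (max 1 (\<sigma> c) - 1) xs))"
      if "length xs = l'" for c xs
    proof -
      have "drop (max 1 (\<sigma> c)) (c # xs) = drop (max 1 (\<sigma> c) - 1) xs"
        by (cases "max 1 (\<sigma> c)") auto
      then show ?thesis using False l' that by (subst rounds.simps) simp
    qed
    have "?G l = (\<integral>\<^sup>+ c. (\<integral>\<^sup>+ xs. of_nat (rounds \<sigma> k (c # xs)) \<partial>measure_pmf (replicate_pmf l' ?p)) \<partial>measure_pmf ?p)"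
      unfolding l' by (rule nn_integral_replicate_pmf_Suc)
    also have "\<dots> = (\<integral>\<^sup>+ c. (1 + ?G (l - max 1 (\<sigma> c))) \<partial>measure_pmf ?p)"
    proof (intro nn_integral_cong)
      fix c
      have "(\<integral>\<^sup>+ xs. of_nat (rounds \<sigma> k (c # xs)) \<partial>measure_pmf (replicate_pmf l' ?p)) =
        (\<integral>\<^sup>+ xs. (1 + of_nat (rounds \<sigma> k (drop (max 1 (\<sigma> c) - 1) xs))) \<partial>measure_pmf (replicate_pmf l' ?p))"
        by (intro nn_integral_cong_AE) (auto simp: AE_measure_pmf_iff set_replicate_pmf unroll)
      also have "\<dots> = 1 + (\<integral>\<^sup>+ xs. of_nat (rounds \<sigma> k xs)
          \<partial>measure_pmf (map_pmf (drop (max 1 (\<sigma> c) - 1)) (replicate_pmf l' ?p)))"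
        by (simp add: nn_integral_add)
      also have "\<dots> = 1 + ?G (l - max 1 (\<sigma> c))"
        by (simp only: map_drop_replicate_pmf) (simp add: l' Suc_diff_le)
      finally show "(\<integral>\<^sup>+ xs. of_nat (rounds \<sigma> k (c # xs)) \<partial>measure_pmf (replicate_pmf l' ?p)) =
        1 + ?G (l - max 1 (\<sigma> c))" .
    qed
    also have "\<dots> \<le> (\<integral>\<^sup>+ c. ennreal (1 + f c) \<partial>measure_pmf ?p)"
      using bound f_nonneg \<Sigma> by (intro nn_integral_mono_AE)
        (auto simp: AE_measure_pmf_iff ennreal_plus simp del: ennreal_plus[symmetric] intro!: add_left_mono)
    also have "\<dots> = ennreal ((\<Sum>c \<in> \<Sigma>. 1 + f c) / real (card \<Sigma>))"
      using \<Sigma> f_nonneg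
      by (simp add: nn_integral_pmf_of_set sum_ennreal divide_ennreal sum_nonneg card_gt_0_iff
          ennreal_of_nat_eq_real_of_nat del: ennreal_plus)
    also have "\<dots> \<le> ennreal (\<alpha> * (real (l - k) + real q))"
    proof (rule ennreal_leI)
      have BS: "B \<subseteq> \<Sigma>" "finite B" using \<Sigma> by (auto simp: B_def)
      have "(\<Sum>c \<in> \<Sigma>. 1 + f c) =
          (\<Sum>c \<in> \<Sigma>. (1 + \<alpha> * (real (l - k) + real q)) - (if c \<in> B then 0 else \<alpha> * (real q / 4)))"
        by (intro sum.cong) (auto simp: f_def algebra_simps)
      also have "\<dots> = real (card \<Sigma>) * (1 + \<alpha> * (real (l - k) + real q)) -
          real (card (\<Sigma> - B)) * (\<alpha> * (real q / 4))"
        using \<Sigma> by (simp add: sum_subtractf sum.If_cases Diff_eq)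
      \<comment> \<open>At least three quarters of the characters lie outside \<open>B\<close> and
        save \<open>4 / 3\<close> each, so the average saving of at least 1 pays for the current
        round.\<close>
      also have "\<alpha> * (real q / 4) = 4 / 3" using q by (simp add: \<alpha>_def)
      also have "real (card (\<Sigma> - B)) = real (card \<Sigma>) - real (card B)"
        using BS \<Sigma> by (simp add: card_Diff_subset card_mono of_nat_diff)
      also have "real (card \<Sigma>) * (1 + \<alpha> * (real (l - k) + real q)) -
          (real (card \<Sigma>) - real (card B)) * (4 / 3) \<le>
          real (card \<Sigma>) * (\<alpha> * (real (l - k) + real q))"
        using rare by (simp add: B_def[symmetric] algebra_simps)
      finally show "(\<Sum>c \<in> \<Sigma>. 1 + f c) / real (card \<Sigma>) \<le> \<alpha> * (real (l - k) + real q)"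
        using \<Sigma> by (simp add: divide_le_eq card_gt_0_iff mult.commute)
    qed
    finally show ?thesis by (simp add: \<alpha>_def)
  qed
qed

text \<open>A displacement of at most \<open>h = q div 4\<close> requires a character among the
  \<open>h\<close> positions of \<open>P\<close> just before \<open>b\<close>, so at most
  \<open>h \<le> card \<Sigma> / 4\<close> characters have one.\<close>

lemma card_small_window_shift_le:
  fixes P :: "'a list"
  assumes sp: "is_sparse P a b" and "finite \<Sigma>" and D: "D \<in> {stated P a b, amended P a b}"
    and q: "q \<le> sublen a b" "q \<le> card \<Sigma>"
  shows "4 * card {c \<in> \<Sigma>. window_shift D P b c \<le> q div 4} \<le> card \<Sigma>"
proof -
  note sp' = is_sparseD[OF sp]
  define h where "h = q div 4"
  have h: "4 * h \<le> b + 1 - a" using q(1) by (simp add: h_def sublen_def)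
  have "c \<in> ch P ` {b - h..<b}" if small: "window_shift D P b c \<le> h" for c
  proof -
    have ne: "c \<noteq> ch P b"
    proof
      assume "c = ch P b"
      then have "window_shift D P b c = max 1 (snd D)" by (simp add: window_shift_def)
      moreover have "b - a \<le> snd D"
        using D by (auto simp: stated_def amended_def stated_jump_def amended_jump_def sublen_def)
      \<comment> \<open>With \<open>4 * h \<le> b + 1 - a\<close> this would give
        \<open>3 * h \<le> 1\<close>, hence \<open>h = 0\<close>. The \<open>max 1\<close> excludes
        that, also for \<open>a = b\<close>.\<close>
      ultimately have "1 \<le> h" "b - a \<le> h" using small by linarith+
      then show False using h sp'(2) by linarith
    qed
    have D_le: "fst D c \<le> h" using small ne by (simp add: window_shift_def)
    have "b + 1 - a \<le> length P" "b + 1 - a \<le> b" "h < b + 1 - a"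
      using sp'(1-3) h by linarith+
    \<comment> \<open>For a character outside the sparse pattern, either table gives a displacement
      of at least \<open>sublen a b\<close>, which exceeds \<open>h\<close>.\<close>
    moreover have "b + 1 - a \<le> fst D c"
      if "c \<notin> ch P ` {a..b}" "b + 1 - a \<le> length P" "b + 1 - a \<le> b"
      using D that by (auto simp only: stated_def amended_def stated_shift_def amended_shift_def
          sublen_def fst_conv if_False split: if_split)
    ultimately have cin: "c \<in> ch P ` {a..b}" using D_le by linarith
    have "fst D c = stated_shift P a b c \<or> fst D c = amended_shift P a b c"
      using D by (auto simp: stated_def amended_def)
    then have s: "shift_in_sparse P a b c \<le> h"
      using D_le unfolding stated_shift_def amended_shift_def if_P[OF cin] by auto
    have "Max {k \<in> {a..b}. ch P k = c} \<in> {k \<in> {a..b}. ch P k = c}"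
      using cin by (intro Max_in) auto
    then obtain k where k: "k \<in> {a..b}" "ch P k = c" "shift_in_sparse P a b c = b - k"
      by (auto simp: shift_in_sparse_def)
    then have "k \<noteq> b" using ne by auto
    then have "k \<in> {b - h..<b}" using k s by auto
    then show ?thesis using k(2) by blast
  qed
  then have "{c \<in> \<Sigma>. window_shift D P b c \<le> h} \<subseteq> ch P ` {b - h..<b}" by blast
  then have "card {c \<in> \<Sigma>. window_shift D P b c \<le> h} \<le> card (ch P ` {b - h..<b})"
    by (intro card_mono) auto
  also have "\<dots> \<le> card {b - h..<b}" by (rule card_image_le) simp
  finally show ?thesis using q(2) by (simp add: h_def)
qed

section \<open>Comparing a random window in a fixed order\<close>

text \<open>Independence of the characters: the expectation of a product of functions of single
  positions factorizes.\<close>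

lemma nn_integral_replicate_pmf_prod:
  fixes g :: "nat \<Rightarrow> 'a \<Rightarrow> ennreal"
  shows "(\<integral>\<^sup>+ xs. (\<Prod>k<m. g k (xs ! k)) \<partial>measure_pmf (replicate_pmf m p)) =
         (\<Prod>k<m. \<integral>\<^sup>+ x. g k x \<partial>measure_pmf p)"
proof (induction m arbitrary: g)
  case (Suc m)
  have "(\<integral>\<^sup>+ xs. (\<Prod>k<Suc m. g k (xs ! k)) \<partial>measure_pmf (replicate_pmf (Suc m) p)) =
    (\<integral>\<^sup>+ x. (\<integral>\<^sup>+ xs. g 0 x * (\<Prod>k<m. g (Suc k) (xs ! k)) \<partial>measure_pmf (replicate_pmf m p)) \<partial>measure_pmf p)"
    unfolding nn_integral_replicate_pmf_Suc prod.lessThan_Suc_shift by simp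
  also have "\<dots> = (\<integral>\<^sup>+ x. g 0 x * (\<Prod>k<m. \<integral>\<^sup>+ x. g (Suc k) x \<partial>measure_pmf p) \<partial>measure_pmf p)"
    by (simp add: nn_integral_cmult Suc.IH[of "\<lambda>k. g (Suc k)"])
  also have "\<dots> = (\<Prod>k<Suc m. \<integral>\<^sup>+ x. g k x \<partial>measure_pmf p)"
    by (simp add: nn_integral_multc prod.lessThan_Suc_shift del: prod.lessThan_Suc)
  finally show ?case .
qed simp

text \<open>The indicator of the event is a product over all positions, with factor 1 outside
  \<open>S\<close>. Only an inequality holds, because \<open>f k\<close> may lie outside
  \<open>\<Sigma>\<close>.\<close>

lemma nn_integral_replicate_pmf_match_le:
  assumes \<Sigma>: "finite \<Sigma>" "\<Sigma> \<noteq> {}" and S: "S \<subseteq> {..<m}"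
  shows "(\<integral>\<^sup>+ xs. (if \<forall>k \<in> S. xs ! k = f k then 1 else 0)
           \<partial>measure_pmf (replicate_pmf m (pmf_of_set \<Sigma>))) \<le> ennreal ((1 / real (card \<Sigma>)) ^ card S)"
proof -
  define g :: "nat \<Rightarrow> 'a \<Rightarrow> ennreal" where "g k x = (if k \<in> S \<and> x \<noteq> f k then 0 else 1)" for k x
  have \<Sigma>_pos: "real (card \<Sigma>) > 0" using \<Sigma> by (simp add: card_gt_0_iff)
  have "(if \<forall>k \<in> S. xs ! k = f k then 1 else 0) = (\<Prod>k<m. g k (xs ! k))" for xs
  proof (cases "\<forall>k \<in> S. xs ! k = f k")
    case False
    then obtain k where "k \<in> S" "xs ! k \<noteq> f k" by blast
    then have "\<exists>k \<in> {..<m}. g k (xs ! k) = 0"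
      using S by (auto simp: g_def)
    then have "(\<Prod>k<m. g k (xs ! k)) = 0"
      by (intro prod_zero) auto
    then show ?thesis using False by (simp only: if_False)
  next
    case True
    then have "(\<Prod>k<m. g k (xs ! k)) = 1" by (intro prod.neutral) (auto simp: g_def)
    then show ?thesis using True by simp
  qed
  then have "(\<integral>\<^sup>+ xs. (if \<forall>k \<in> S. xs ! k = f k then 1 else 0)
      \<partial>measure_pmf (replicate_pmf m (pmf_of_set \<Sigma>))) = (\<Prod>k<m. \<integral>\<^sup>+ x. g k x \<partial>measure_pmf (pmf_of_set \<Sigma>))"
    by (simp add: nn_integral_replicate_pmf_prod)
  also have "\<dots> \<le> (\<Prod>k<m. if k \<in> S then ennreal (1 / real (card \<Sigma>)) else 1)"
  proof (rule prod_mono_ennreal)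
    fix k
    show "(\<integral>\<^sup>+ x. g k x \<partial>measure_pmf (pmf_of_set \<Sigma>)) \<le> (if k \<in> S then ennreal (1 / real (card \<Sigma>)) else 1)"
    proof (cases "k \<in> S")
      case True
      have "(\<Sum>x \<in> \<Sigma>. g k x) = (\<Sum>x \<in> \<Sigma>. if x = f k then 1 else 0)"
        using True by (intro sum.cong) (auto simp: g_def)
      also have "\<dots> \<le> 1" using \<Sigma> by (simp add: sum.delta)
      finally have "(\<Sum>x \<in> \<Sigma>. g k x) / ennreal (real (card \<Sigma>)) \<le> ennreal 1 / ennreal (real (card \<Sigma>))"
        by (intro divide_right_mono_ennreal) simp
      then show ?thesis
        using True \<Sigma> \<Sigma>_pos
        by (subst (asm) divide_ennreal) (auto simp: nn_integral_pmf_of_set ennreal_of_nat_eq_real_of_nat)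
    qed (simp add: g_def)
  qed
  also have "\<dots> = ennreal (1 / real (card \<Sigma>)) ^ card S"
  proof -
    have "{..<m} \<inter> S = S" using S by auto
    then show ?thesis by (simp add: prod.If_cases)
  qed
  finally show ?thesis using \<Sigma>_pos by (simp add: ennreal_power)
qed

lemma nn_integral_match_positions_le:
  assumes \<Sigma>: "finite \<Sigma>" "\<Sigma> \<noteq> {}" and i: "i + length P \<le> m" and S: "S \<subseteq> {1..length P}"
  shows "(\<integral>\<^sup>+ T. (if \<forall>k \<in> S. ch P k = ch T (i + k) then 1 else 0)
           \<partial>measure_pmf (replicate_pmf m (pmf_of_set \<Sigma>))) \<le> ennreal ((1 / real (card \<Sigma>)) ^ card S)"
proof -
  define S' where "S' = (\<lambda>k. i + k - 1) ` S"
  have "inj_on (\<lambda>k. i + k - 1) S"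
  proof (rule inj_onI)
    fix x y assume "x \<in> S" "y \<in> S" "i + x - 1 = i + y - 1"
    moreover from this have "1 \<le> x" "1 \<le> y" using S by auto
    ultimately show "x = y" by linarith
  qed
  then have card: "card S' = card S" by (simp add: S'_def card_image)
  have "(\<forall>k \<in> S. ch P k = ch T (i + k)) \<longleftrightarrow> (\<forall>j \<in> S'. T ! j = P ! (j - i))" for T :: "'a list"
  proof -
    have "(\<forall>j \<in> S'. T ! j = P ! (j - i)) \<longleftrightarrow> (\<forall>k \<in> S. ch T (i + k) = P ! (i + k - 1 - i))"
      by (simp add: S'_def)
    also have "\<dots> \<longleftrightarrow> (\<forall>k \<in> S. ch P k = ch T (i + k))"
    proof (intro ball_cong refl)
      fix k assume "k \<in> S"
      then have "1 \<le> k" using S by auto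
      then have "i + k - 1 - i = k - 1" by simp
      then show "ch T (i + k) = P ! (i + k - 1 - i) \<longleftrightarrow> ch P k = ch T (i + k)" by metis
    qed
    finally show ?thesis by simp
  qed
  moreover have "S' \<subseteq> {..<m}" using S i by (force simp: S'_def)
  ultimately show ?thesis
    using nn_integral_replicate_pmf_match_le[OF \<Sigma>, of S' m "\<lambda>j. P ! (j - i)"] card by simp
qed

text \<open>
  Every comparison outside the positions \<open>S\<close> already known to match succeeds with probability
  \<open>1 / |\<Sigma>| \<le> 1 / 2\<close>, so two comparisons are expected, and one more if \<open>b \<in> S\<close> is compared again.
\<close>

lemma nn_integral_match_in_order_le_aux:
  assumes \<Sigma>: "finite \<Sigma>" "2 \<le> card \<Sigma>" and i: "i + length P \<le> m"
    and "distinct ks" "set ks \<subseteq> {1..length P}" "S \<subseteq> {1..length P}" "b \<in> S" "set ks \<inter> S \<subseteq> {b}"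
  shows "(\<integral>\<^sup>+ T. (if \<forall>k \<in> S. ch P k = ch T (i + k) then of_nat (snd (match_in_order P T i ks)) else 0)
           \<partial>measure_pmf (replicate_pmf m (pmf_of_set \<Sigma>)))
         \<le> ennreal ((1 / real (card \<Sigma>)) ^ card S * (if b \<in> set ks then 3 else 2))"
    (is "?F S ks \<le> _")
  using assms(4-)
proof (induction ks arbitrary: S)
  case (Cons k ks)
  let ?p = "1 / real (card \<Sigma>)"
  let ?E = "\<lambda>S T. \<forall>k \<in> S. ch P k = ch T (i + k)"
  have \<Sigma>_ne: "\<Sigma> \<noteq> {}" using \<Sigma> by auto
  have p: "0 \<le> ?p" "?p \<le> 1 / 2" using \<Sigma> by (auto simp: field_simps)
  \<comment> \<open>On the event that \<open>S\<close> matches, the comparison at \<open>k\<close>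
    costs one step, and the remaining ones are made only if \<open>insert k S\<close>
    matches.\<close>
  have "(if ?E S T then of_nat (snd (match_in_order P T i (k # ks))) else 0) =
      (if ?E S T then 1 else 0) +
      (if ?E (insert k S) T then of_nat (snd (match_in_order P T i ks)) else (0 :: ennreal))" for T
    by (auto simp: case_prod_beta)
  then have "?F S (k # ks) = (\<integral>\<^sup>+ T. (if ?E S T then 1 else 0) +
      (if ?E (insert k S) T then of_nat (snd (match_in_order P T i ks)) else 0)
      \<partial>measure_pmf (replicate_pmf m (pmf_of_set \<Sigma>)))"
    by (intro nn_integral_cong)
  also have "\<dots> = (\<integral>\<^sup>+ T. (if ?E S T then 1 else 0)
      \<partial>measure_pmf (replicate_pmf m (pmf_of_set \<Sigma>))) + ?F (insert k S) ks"
    by (rule nn_integral_add) simp_all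
  also have "\<dots> \<le> ennreal (?p ^ card S) +
      ennreal (?p ^ card (insert k S) * (if b \<in> set ks then 3 else 2))"
    using Cons.prems by (intro add_mono nn_integral_match_positions_le Cons.IH \<Sigma> \<Sigma>_ne i) auto
  also have "\<dots> = ennreal (?p ^ card S + ?p ^ card (insert k S) * (if b \<in> set ks then 3 else 2))"
    using p(1) by (intro ennreal_plus[symmetric] mult_nonneg_nonneg zero_le_power) auto
  also have "\<dots> \<le> ennreal (?p ^ card S * (if b \<in> set (k # ks) then 3 else 2))"
  proof (rule ennreal_leI)
    show "?p ^ card S + ?p ^ card (insert k S) * (if b \<in> set ks then 3 else 2)
        \<le> ?p ^ card S * (if b \<in> set (k # ks) then 3 else 2)"
    proof (cases "k = b")
      case True
      \<comment> \<open>Comparing \<open>b\<close> again leaves \<open>S\<close> unchanged, and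
        \<open>b\<close> does not recur in \<open>ks\<close>; so the factor is
        \<open>1 + 2 = 3\<close>.\<close>
      then show ?thesis using Cons.prems by (simp add: insert_absorb)
    next
      case False
      have "finite S" using Cons.prems(3) finite_subset by blast
      moreover have "k \<notin> S" using False Cons.prems(5) by auto
      ultimately have "card (insert k S) = Suc (card S)" by simp
      then have "?p ^ card S + ?p ^ card (insert k S) * (if b \<in> set ks then 3 else 2) =
          ?p ^ card S * (1 + ?p * (if b \<in> set ks then 3 else 2))"
        by (simp add: algebra_simps)
      \<comment> \<open>From \<open>?p \<le> 1 / 2\<close>: \<open>1 + ?p * 2 \<le> 2\<close> and
        \<open>1 + ?p * 3 \<le> 3\<close>.\<close>
      also have "\<dots> \<le> ?p ^ card S * (if b \<in> set (k # ks) then 3 else 2)"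
        using p False by (intro mult_left_mono zero_le_power) auto
      finally show ?thesis .
    qed
  qed
  finally show ?case .
qed (simp cong: if_cong)

lemma nn_integral_match_in_order_le:
  assumes "finite \<Sigma>" "2 \<le> card \<Sigma>" "i + length P \<le> m" "distinct ks" "set ks \<subseteq> {1..length P}"
    "b \<in> {1..length P}"
  shows "(\<integral>\<^sup>+ T. (if ch T (i + b) = ch P b then of_nat (snd (match_in_order P T i ks)) else 0)
           \<partial>measure_pmf (replicate_pmf m (pmf_of_set \<Sigma>))) \<le> ennreal (3 / real (card \<Sigma>))"
proof -
  have eq: "ch T (i + b) = ch P b \<longleftrightarrow> (\<forall>k \<in> {b}. ch P k = ch T (i + k))" for T
    by auto
  have "(\<integral>\<^sup>+ T. (if ch T (i + b) = ch P b then of_nat (snd (match_in_order P T i ks)) else 0)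
      \<partial>measure_pmf (replicate_pmf m (pmf_of_set \<Sigma>))) \<le>
      ennreal ((1 / real (card \<Sigma>)) ^ card {b} * (if b \<in> set ks then 3 else 2))"
    unfolding eq by (rule nn_integral_match_in_order_le_aux[OF assms(1-5)]) (use assms(6) in auto)
  also have "\<dots> \<le> ennreal (3 / real (card \<Sigma>))"
    by (intro ennreal_leI) (simp add: divide_right_mono)
  finally show ?thesis .
qed

section \<open>Expected running time\<close>

lemma expected_time_leI:
  assumes "0 \<le> B" "(\<integral>\<^sup>+ T. (\<integral>\<^sup>+ x. of_nat (snd x) \<partial>measure_pmf (alg T))
      \<partial>measure_pmf (replicate_pmf m (pmf_of_set \<Sigma>))) \<le> ennreal B"
  shows "expected_time \<Sigma> m alg \<le> B"
  unfolding expected_time_def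
  using assms by (intro integral_real_bounded) (simp_all add: case_prod_beta ennreal_of_nat_eq_real_of_nat)

text \<open>Shared by both algorithms: \<open>w T j\<close> bounds the cost of verifying window
  \<open>j\<close> of text \<open>T\<close>, whatever the history of the search.\<close>

lemma expected_time_search_le:
  fixes P :: "'a list" and w :: "'a list \<Rightarrow> nat \<Rightarrow> ennreal"
  assumes \<Sigma>: "finite \<Sigma>" "\<Sigma> \<noteq> {}" and sp: "is_sparse P a b"
    and D: "D \<in> {stated P a b, amended P a b}"
    and time: "\<And>T. length T = m \<Longrightarrow> (\<integral>\<^sup>+ x. of_nat (snd x) \<partial>measure_pmf (alg T)) \<le>
        2 * of_nat (rounds (window_shift D P b) (length P - b) (drop (0 + b - 1) T)) +
        (\<Sum>j = 0..<Suc (length T) - length P. if ch T (j + b) = ch P b then w T j else 0)"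
    and cost: "\<And>j. j + length P \<le> m \<Longrightarrow>
        (\<integral>\<^sup>+ T. (if ch T (j + b) = ch P b then w T j else 0)
          \<partial>measure_pmf (replicate_pmf m (pmf_of_set \<Sigma>))) \<le> ennreal (3 / real (card \<Sigma>))"
  shows "expected_time \<Sigma> m alg \<le> 25 * (real m / real (min (sublen a b) (card \<Sigma>)))"
proof (rule expected_time_leI)
  let ?M = "measure_pmf (replicate_pmf m (pmf_of_set \<Sigma>))"
  let ?r = "rounds (window_shift D P b) (length P - b)"
  let ?n = "length P"
  note sp' = is_sparseD[OF sp]
  define q where "q = min (sublen a b) (card \<Sigma>)"
  have q: "0 < q" "q \<le> ?n" "q \<le> card \<Sigma>" "q \<le> sublen a b"
    using sp' \<Sigma> by (auto simp: q_def sublen_def card_gt_0_iff)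
  show "0 \<le> 25 * (real m / real (min (sublen a b) (card \<Sigma>)))" by simp
  have "(\<integral>\<^sup>+ T. (\<integral>\<^sup>+ x. of_nat (snd x) \<partial>measure_pmf (alg T)) \<partial>?M) \<le>
     (\<integral>\<^sup>+ T. 2 * of_nat (?r (drop (b - 1) T)) +
        (\<Sum>j = 0..<Suc m - ?n. if ch T (j + b) = ch P b then w T j else 0) \<partial>?M)"
    using time by (intro nn_integral_mono_AE) (auto simp: AE_measure_pmf_iff set_replicate_pmf)
  also have "\<dots> = 2 * (\<integral>\<^sup>+ T. of_nat (?r (drop (b - 1) T)) \<partial>?M) +
      (\<Sum>j = 0..<Suc m - ?n. \<integral>\<^sup>+ T. (if ch T (j + b) = ch P b then w T j else 0) \<partial>?M)"
    by (simp add: nn_integral_add nn_integral_cmult nn_integral_sum)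
  also have "\<dots> \<le> ennreal (25 * (real m / real q))"
  proof (cases "m < ?n")
    case True
    have "(\<integral>\<^sup>+ T. of_nat (?r (drop (b - 1) T)) \<partial>?M) = (\<integral>\<^sup>+ T. 0 \<partial>?M)"
      using True sp' by (intro nn_integral_cong_AE)
        (auto simp: AE_measure_pmf_iff set_replicate_pmf rounds.simps)
    then show ?thesis using True by simp
  next
    case False
    have "(\<integral>\<^sup>+ T. of_nat (?r (drop (b - 1) T)) \<partial>?M) =
        (\<integral>\<^sup>+ xs. of_nat (?r xs) \<partial>measure_pmf (replicate_pmf (m - (b - 1)) (pmf_of_set \<Sigma>)))"
      by (simp add: map_drop_replicate_pmf[symmetric])
    also have "\<dots> \<le> ennreal (16 / (3 * real q) * (real (m - (b - 1) - (?n - b)) + real q))"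
      using \<Sigma> q by (intro nn_integral_rounds_le card_small_window_shift_le[OF sp _ D])
    \<comment> \<open>There are \<open>m + 1 - n \<le> m\<close> window positions, and
      \<open>q \<le> n \<le> m\<close>.\<close>
    also have "\<dots> \<le> ennreal (16 / (3 * real q) * (2 * real m))"
      using False sp' q by (intro ennreal_leI mult_left_mono) auto
    finally have "2 * (\<integral>\<^sup>+ T. of_nat (?r (drop (b - 1) T)) \<partial>?M) \<le>
        ennreal 2 * ennreal (16 / (3 * real q) * (2 * real m))"
      by (intro mult_mono) auto
    also have "\<dots> = ennreal (64 / 3 * (real m / real q))"
      by (subst ennreal_mult[symmetric]) (auto simp: field_simps)
    finally have 1: "2 * (\<integral>\<^sup>+ T. of_nat (?r (drop (b - 1) T)) \<partial>?M) \<le>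
        ennreal (64 / 3 * (real m / real q))" .
    have "(\<Sum>j = 0..<Suc m - ?n. \<integral>\<^sup>+ T. (if ch T (j + b) = ch P b then w T j else 0) \<partial>?M) \<le>
        (\<Sum>j = 0..<Suc m - ?n. ennreal (3 / real (card \<Sigma>)))"
      using False by (intro sum_mono cost) auto
    also have "\<dots> = ennreal (real (Suc m - ?n) * (3 / real (card \<Sigma>)))"
      by (subst ennreal_mult) (simp_all add: ennreal_of_nat_eq_real_of_nat)
    also have "\<dots> \<le> ennreal (3 * (real m / real q))"
    proof (rule ennreal_leI)
      have "real (Suc m - ?n) * (3 / real (card \<Sigma>)) \<le> real m * (3 / real q)"
        using q False by (intro mult_mono divide_left_mono) auto
      then show "real (Suc m - ?n) * (3 / real (card \<Sigma>)) \<le> 3 * (real m / real q)"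
        by (simp add: mult.commute)
    qed
    finally have 2: "(\<Sum>j = 0..<Suc m - ?n. \<integral>\<^sup>+ T. (if ch T (j + b) = ch P b then w T j else 0) \<partial>?M)
        \<le> ennreal (3 * (real m / real q))" .
    \<comment> \<open>The reads of the loop and the verifier together cost
      \<open>73 / 3 \<le> 25\<close> times \<open>m / q\<close>.\<close>
    have "ennreal (64 / 3 * (real m / real q)) + ennreal (3 * (real m / real q)) =
        ennreal (64 / 3 * (real m / real q) + 3 * (real m / real q))"
      by (intro ennreal_plus[symmetric]) auto
    also have "\<dots> \<le> ennreal (25 * (real m / real q))"
    proof (rule ennreal_leI)
      have "0 \<le> real m / real q" by simp
      then show "64 / 3 * (real m / real q) + 3 * (real m / real q) \<le> 25 * (real m / real q)"
        by linarith
    qed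
    finally show ?thesis using add_mono[OF 1 2] by (rule order_trans[rotated])
  qed
  finally show "(\<integral>\<^sup>+ T. (\<integral>\<^sup>+ x. of_nat (snd x) \<partial>measure_pmf (alg T)) \<partial>?M) \<le>
      ennreal (25 * (real m / real (min (sublen a b) (card \<Sigma>))))"
    by (simp add: q_def)
qed

lemma memo_valid_0: "memo_valid P T (\<lambda>_. 0)"
  by (simp add: memo_valid_def)

text \<open>The plain right-to-left comparison serves as \<open>w\<close>: it bounds every call
  independently of \<open>M\<close> and has a fixed order.\<close>

lemma expected_time_algorithm_A_le:
  fixes P :: "'a list"
  assumes \<Sigma>: "finite \<Sigma>" "2 \<le> card \<Sigma>" and sp: "is_sparse P a b"
    and D: "D \<in> {stated P a b, amended P a b}"
  shows "expected_time \<Sigma> m (algorithm_A D P a b)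
           \<le> 25 * (real m / real (min (sublen a b) (card \<Sigma>)))"
proof (rule expected_time_search_le[OF \<Sigma>(1) _ sp D])
  let ?ks = "rev [1..<Suc (length P)]"
  let ?w = "\<lambda>T j. of_nat (snd (match_in_order P T j ?ks)) :: ennreal"
  note sp' = is_sparseD[OF sp]
  show "\<Sigma> \<noteq> {}" using \<Sigma> by auto
  show "(\<integral>\<^sup>+ x. of_nat (snd x) \<partial>measure_pmf (algorithm_A D P a b T)) \<le>
        2 * of_nat (rounds (window_shift D P b) (length P - b) (drop (0 + b - 1) T)) +
        (\<Sum>j = 0..<Suc (length T) - length P. if ch T (j + b) = ch P b then ?w T j else 0)" for T
    unfolding algorithm_A_def
  proof (rule nn_integral_search_le[OF correct_verifier_apostolico_giancarlo])
    fix j M assume "memo_valid P T M" "j + length P \<le> length T"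
    note result = apostolico_giancarlo_result(3)[OF this]
    have "(\<integral>\<^sup>+ x. of_nat (fst (snd x)) \<partial>measure_pmf (apostolico_giancarlo P T j M)) \<le>
        (\<integral>\<^sup>+ x. ?w T j \<partial>measure_pmf (apostolico_giancarlo P T j M))"
      using result by (intro nn_integral_mono_AE)
        (auto simp: AE_measure_pmf_iff simp del: upt_Suc)
    then show "(\<integral>\<^sup>+ x. of_nat (fst (snd x)) \<partial>measure_pmf (apostolico_giancarlo P T j M)) \<le> ?w T j"
      by simp
  qed (use sp' memo_valid_0 in auto)
  show "(\<integral>\<^sup>+ T. (if ch T (j + b) = ch P b then ?w T j else 0)
      \<partial>measure_pmf (replicate_pmf m (pmf_of_set \<Sigma>))) \<le> ennreal (3 / real (card \<Sigma>))"
    if "j + length P \<le> m" for j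
    using sp' that by (intro nn_integral_match_in_order_le \<Sigma>) auto
qed

text \<open>The order is drawn independently of the text, so averaging over the orders may be
  exchanged with the expectation over the text; each fixed order then obeys the same bound.\<close>

lemma expected_time_algorithm_B_le:
  fixes P :: "'a list"
  assumes \<Sigma>: "finite \<Sigma>" "2 \<le> card \<Sigma>" and sp: "is_sparse P a b"
    and D: "D \<in> {stated P a b, amended P a b}"
  shows "expected_time \<Sigma> m (algorithm_B D P a b)
           \<le> 25 * (real m / real (min (sublen a b) (card \<Sigma>)))"
proof (rule expected_time_search_le[OF \<Sigma>(1) _ sp D])
  let ?K = "permutations_of_set {1..length P}"
  let ?w = "\<lambda>T j. \<integral>\<^sup>+ ks. of_nat (snd (match_in_order P T j ks)) \<partial>measure_pmf (pmf_of_set ?K)"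
  let ?M = "measure_pmf (replicate_pmf m (pmf_of_set \<Sigma>))"
  note sp' = is_sparseD[OF sp]
  show "\<Sigma> \<noteq> {}" using \<Sigma> by auto
  show "(\<integral>\<^sup>+ x. of_nat (snd x) \<partial>measure_pmf (algorithm_B D P a b T)) \<le>
        2 * of_nat (rounds (window_shift D P b) (length P - b) (drop (0 + b - 1) T)) +
        (\<Sum>j = 0..<Suc (length T) - length P. if ch T (j + b) = ch P b then ?w T j else 0)" for T
    unfolding algorithm_B_def
  proof (rule nn_integral_search_le[OF correct_verifier_random_match])
    show "(\<integral>\<^sup>+ x. of_nat (fst (snd x)) \<partial>measure_pmf (random_match P T j s)) \<le> ?w T j" for j s
      unfolding random_match_def by (simp add: case_prod_beta)
  qed (use sp' in auto)
  show "(\<integral>\<^sup>+ T. (if ch T (j + b) = ch P b then ?w T j else 0) \<partial>?M) \<le> ennreal (3 / real (card \<Sigma>))"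
    if j: "j + length P \<le> m" for j
  proof -
    have K: "finite ?K" "?K \<noteq> {}" by auto
    have "(\<integral>\<^sup>+ T. (if ch T (j + b) = ch P b then ?w T j else 0) \<partial>?M) =
        (\<integral>\<^sup>+ T. (\<Sum>ks \<in> ?K. if ch T (j + b) = ch P b then of_nat (snd (match_in_order P T j ks)) else 0)
           / of_nat (card ?K) \<partial>?M)"
      unfolding nn_integral_pmf_of_set[OF K(2,1)]
      by (intro nn_integral_cong) (simp add: ennreal_of_nat_eq_real_of_nat)
    also have "\<dots> = (\<Sum>ks \<in> ?K. \<integral>\<^sup>+ T. (if ch T (j + b) = ch P b
          then of_nat (snd (match_in_order P T j ks)) else 0) \<partial>?M) / of_nat (card ?K)"
      by (simp add: nn_integral_divide nn_integral_sum)
    also have "\<dots> \<le> (\<Sum>ks \<in> ?K. ennreal (3 / real (card \<Sigma>))) / of_nat (card ?K)"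
      using sp' j
      by (intro divide_right_mono_ennreal sum_mono nn_integral_match_in_order_le \<Sigma>)
        (auto simp: permutations_of_setD)
    also have "\<dots> = ennreal (3 / real (card \<Sigma>))"
    proof -
      have "card ?K > 0" using K by (simp only: card_gt_0_iff) simp
      then show ?thesis
        by (simp add: ennreal_of_nat_eq_real_of_nat ennreal_mult[symmetric] divide_ennreal del: card_permutations_of_set)
    qed
    finally show ?thesis .
  qed
qed

section \<open>Alphabets of size one\<close>

lemma ag_scan_time_fresh:
  assumes "d \<le> k" "\<And>r. k - d < r \<Longrightarrow> r \<le> k \<Longrightarrow> M (i + r) = 0 \<and> ch P r = ch T (i + r)"
  shows "fst (snd (ag_scan P T M i k)) = d + fst (snd (ag_scan P T M i (k - d)))"
  using assms
proof (induction d arbitrary: k)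
  case (Suc d)
  then have "fst (snd (ag_scan P T M i k)) = 1 + fst (snd (ag_scan P T M i (k - 1)))"
    by (subst ag_scan.simps) (auto simp: case_prod_beta)
  also have "fst (snd (ag_scan P T M i (k - 1))) = d + fst (snd (ag_scan P T M i (k - 1 - d)))"
    using Suc.prems by (intro Suc.IH) auto
  finally show ?case by simp
qed simp

lemma ch_unary: "set xs \<subseteq> {x} \<Longrightarrow> 0 < k \<Longrightarrow> k \<le> length xs \<Longrightarrow> ch xs k = x"
  using nth_mem[of "k - 1" xs] by fastforce

text \<open>A shorter length would exhibit a mismatch between two characters of a one-letter
  string.\<close>

lemma suffix_len_unary:
  assumes "set P \<subseteq> {x}" "k \<le> length P"
  shows "suffix_len P k = k"
proof (rule ccontr)
  assume "suffix_len P k \<noteq> k"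
  then have "suffix_len P k < k" using suffix_len_le[OF assms(2)] by simp
  then show False
    using suffix_len_mismatch[OF assms(2)] ch_unary[OF assms(1)] assms(2)
    by (metis diff_le_self le_trans less_le_trans zero_less_diff)
qed

text \<open>
  Here the previous window ended \<open>J\<close> positions before the current one and has left a full entry
  in \<open>M\<close>; the scan reaches it after \<open>J\<close> comparisons and stops.
\<close>

lemma search_unary_time:
  fixes P T :: "'a list"
  defines "n \<equiv> length P"
  assumes x: "set P \<subseteq> {x}" "set T \<subseteq> {x}" and ab: "1 \<le> a" "a \<le> b" "b \<le> n"
    and J: "J = max 1 (snd D)" "J \<le> 2" "J \<le> n"
    and "memo_valid P T M" "J \<le> i" "M (i + n - J) = n" "\<And>j. i + n - J < j \<Longrightarrow> M j = 0"
    and "(R, t) \<in> set_pmf (search apostolico_giancarlo D P a b T i M)"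
  shows "t \<le> 5 * (Suc (length T) - n - i)"
  using assms(10-)
proof (induction "Suc (length T) - i" arbitrary: i M R t rule: less_induct)
  case less
  have ch: "ch P k = x" if "0 < k" "k \<le> n" for k
    using ch_unary[OF x(1)] that by (simp add: n_def)
  have chT: "ch T k = x" if "0 < k" "k \<le> length T" for k
    using ch_unary[OF x(2)] that by simp
  show ?case
  proof (cases "length T < i + length P")
    case True
    then show ?thesis using less.prems by (simp add: search_end)
  next
    case False
    have Ti: "ch T (i + k) = x" if "0 < k" "k \<le> n" for k
      using that False by (intro chT) (auto simp: n_def)
    from less.prems(5) False show ?thesis
    proof (cases rule: set_pmf_searchE)
      case (verify found t'' M' R' t')
      then obtain l where l: "ag_scan P T M i n = (found, t'', l)" "M' = M(i + n := l)"
        by (auto simp: apostolico_giancarlo_def n_def split: prod.splits)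
      have M': "memo_valid P T M'"
        using apostolico_giancarlo_result(2)[OF less.prems(1) _ verify(2)] False by simp
      have "ln": "l = n"
        using ag_scan_correct[OF less.prems(1) _ _ l(1)] ch Ti by (auto simp: n_def)
      have "t'' = J + fst (snd (ag_scan P T M i (n - J)))"
        using ag_scan_time_fresh[of J n M i P T] l(1) J(3) less.prems(4) ch Ti by auto
      \<comment> \<open>At \<open>k = n - J\<close> either nothing is left, or the full entry
        \<open>n\<close> exceeds \<open>suffix_len P k = k\<close> and the scan succeeds at
        once.\<close>
      moreover have "fst (snd (ag_scan P T M i (n - J))) \<le> 1"
      proof (cases "n = J")
        case True
        then show ?thesis by (simp add: ag_scan.simps)
      next
        case False
        have "suffix_len P (n - J) = n - J"
          using x(1) by (intro suffix_len_unary) (auto simp: n_def)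
        moreover have "M (i + (n - J)) = n" using less.prems(3) J(3) by simp
        moreover have "n - J < n" "0 < n - J" using False J by auto
        ultimately show ?thesis by (subst ag_scan.simps) auto
      qed
      \<comment> \<open>Together with the two reads of the loop, this is five units per
        window.\<close>
      ultimately have "t'' \<le> 3" using J(2) by linarith
      moreover have "t' \<le> 5 * (Suc (length T) - n - (i + J))"
      proof (rule less.hyps)
        show "(R', t') \<in> set_pmf (search apostolico_giancarlo D P a b T (i + J) M')"
          using verify(3) J(1) by simp
      qed (use M' less.prems l(2) "ln" J False ab in \<open>auto simp: n_def\<close>)
      moreover have "Suc (length T) - n - (i + J) + 1 \<le> Suc (length T) - n - i"
        using False J(1) by (auto simp: n_def)
      ultimately show ?thesis using verify(5) by linarith
    qed (use ch[of b] Ti[of b] ch[of a] Ti[of a] ab in auto)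
  qed
qed

text \<open>Only the first call meets an empty table and may take \<open>n \<le> length T\<close>
  steps; it leaves the full entry on which \<open>search_unary_time\<close> relies.\<close>

lemma algorithm_A_unary_time:
  fixes P T :: "'a list"
  assumes x: "set P \<subseteq> {x}" "set T \<subseteq> {x}" and sp: "is_sparse P a b"
    and D: "D \<in> {stated P a b, amended P a b}"
    and res: "(R, t) \<in> set_pmf (algorithm_A D P a b T)"
  shows "t \<le> 7 * length T"
proof -
  define n where "n = length P"
  define J where "J = max 1 (snd D)"
  note sp' = is_sparseD[OF sp]
  have ch: "ch P k = x" if "0 < k" "k \<le> n" for k
    using ch_unary[OF x(1)] that by (simp add: n_def)
  have chT: "ch T k = x" if "0 < k" "k \<le> length T" for k
    using ch_unary[OF x(2)] that by simp
  \<comment> \<open>An interior character would equal the end characters; hence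
    \<open>sublen a b \<le> 2\<close>, which bounds the jump of either table.\<close>
  have "b \<le> a + 1"
  proof (rule ccontr)
    assume "\<not> b \<le> a + 1"
    then show False using sp'(4)[of "a + 1"] ch[of a] ch[of "a + 1"] sp' by (auto simp: n_def)
  qed
  then have J: "J \<le> 2" "J \<le> n"
    using D sp' ch[of a] ch[of b]
    by (auto simp: J_def n_def stated_def amended_def stated_jump_def amended_jump_def sublen_def)
  show ?thesis
  proof (cases "length T < 0 + length P")
    case True
    then show ?thesis using res by (simp add: algorithm_A_def search_end)
  next
    case False
    from res have "(R, t) \<in> set_pmf (search apostolico_giancarlo D P a b T 0 (\<lambda>_. 0))"
      by (simp add: algorithm_A_def)
    then show ?thesis using False
    proof (cases rule: set_pmf_searchE)
      case (verify found t'' M' R' t')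
      then obtain l where l: "ag_scan P T (\<lambda>_. 0) 0 n = (found, t'', l)" "M' = (\<lambda>_. 0)(n := l)"
        by (auto simp: apostolico_giancarlo_def n_def split: prod.splits)
      note result = apostolico_giancarlo_result[OF memo_valid_0 _ verify(2)]
      have "ln": "l = n"
        using ag_scan_correct[OF memo_valid_0 _ _ l(1)] ch chT False by (auto simp: n_def)
      have "t'' \<le> snd (match_in_order P T 0 (rev [1..<Suc (length P)]))"
        using result(3) False by simp
      also have "\<dots> \<le> length (rev [1..<Suc (length P)])" by (rule match_in_order_le)
      finally have "t'' \<le> n" by (simp add: n_def del: upt_Suc)
      moreover have "t' \<le> 5 * (Suc (length T) - length P - J)"
        using x sp'(1-3) J_def J(1) J(2)[unfolded n_def] result(2)
      proof (rule search_unary_time)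
        show "(R', t') \<in> set_pmf (search apostolico_giancarlo D P a b T J M')"
          using verify(3) by (simp add: J_def)
      qed (use False l(2) "ln" in \<open>auto simp: n_def\<close>)
      moreover have "1 \<le> n" "1 \<le> J" "n \<le> length T" using J(2) False by (auto simp: n_def J_def)
      ultimately show ?thesis using verify(5) by (simp add: n_def)
    qed (use ch[of b] chT[of b] ch[of a] chT[of a] sp'(1-3) False in \<open>auto simp: n_def\<close>)
  qed
qed

lemma expected_time_algorithm_A_unary_le:
  fixes P :: "'a list"
  assumes "set P \<subseteq> {x}" "is_sparse P a b" "D \<in> {stated P a b, amended P a b}"
  shows "expected_time {x} m (algorithm_A D P a b) \<le> 7 * real m"
proof (rule expected_time_leI)
  have "(\<integral>\<^sup>+ T. (\<integral>\<^sup>+ y. of_nat (snd y) \<partial>measure_pmf (algorithm_A D P a b T))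
      \<partial>measure_pmf (replicate_pmf m (pmf_of_set {x}))) \<le>
    (\<integral>\<^sup>+ T. (\<integral>\<^sup>+ y. ennreal (7 * real m) \<partial>measure_pmf (algorithm_A D P a b T))
      \<partial>measure_pmf (replicate_pmf m (pmf_of_set {x})))"
  proof (intro nn_integral_mono_AE, subst AE_measure_pmf_iff, intro ballI nn_integral_mono_AE,
      subst AE_measure_pmf_iff, intro ballI)
    fix T y
    assume T: "T \<in> set_pmf (replicate_pmf m (pmf_of_set {x}))"
      and y: "y \<in> set_pmf (algorithm_A D P a b T)"
    have "set T \<subseteq> {x}" "length T = m" using T by (auto simp: set_replicate_pmf)
    moreover have "(fst y, snd y) \<in> set_pmf (algorithm_A D P a b T)" using y by simp
    ultimately have "snd y \<le> 7 * m" using algorithm_A_unary_time[OF assms(1) _ assms(2,3)] by blast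
    then have "ennreal (real (snd y)) \<le> ennreal (7 * real m)" by (intro ennreal_leI) linarith
    then show "of_nat (snd y) \<le> ennreal (7 * real m)" by (simp add: ennreal_of_nat_eq_real_of_nat)
  qed
  then show "(\<integral>\<^sup>+ T. (\<integral>\<^sup>+ y. of_nat (snd y) \<partial>measure_pmf (algorithm_A D P a b T))
      \<partial>measure_pmf (replicate_pmf m (pmf_of_set {x}))) \<le> ennreal (7 * real m)"
    by simp
qed simp

text \<open>\<open>C\<close> is chosen before all other data, so the bound is uniform. For the
  stated tables, which can skip occurrences, correctness is limited to soundness; the time bound
  covers both tables.\<close>

theorem theorem2:
  shows "\<exists>C :: real. 0 < C \<and>
    (\<forall>(\<Sigma> :: 'a set) P a b. finite \<Sigma> \<and> set P \<subseteq> \<Sigma> \<and> is_sparse P a b \<longrightarrow>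
       card (set P) \<le> sublen a b \<and>
       (\<forall>T. set T \<subseteq> \<Sigma> \<longrightarrow>
          (\<forall>(R, t) \<in> set_pmf (algorithm_A (amended P a b) P a b T). R = occurrences P T) \<and>
          (\<forall>(R, t) \<in> set_pmf (algorithm_B (amended P a b) P a b T). R = occurrences P T) \<and>
          (\<forall>(R, t) \<in> set_pmf (algorithm_A (stated P a b) P a b T). R \<subseteq> occurrences P T) \<and>
          (\<forall>(R, t) \<in> set_pmf (algorithm_B (stated P a b) P a b T). R \<subseteq> occurrences P T)) \<and>
       (\<forall>m. \<forall>D \<in> {stated P a b, amended P a b}.
          expected_time \<Sigma> m (algorithm_A D P a b)
            \<le> C * (real m / real (min (sublen a b) (card \<Sigma>))) \<and>
          (2 \<le> card \<Sigma> \<longrightarrow>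
            expected_time \<Sigma> m (algorithm_B D P a b)
              \<le> C * (real m / real (min (sublen a b) (card \<Sigma>))))))"
proof (intro exI[of _ 25] conjI allI impI; (elim conjE)?)
  fix \<Sigma> :: "'a set" and P a b
  assume \<Sigma>: "finite \<Sigma>" "set P \<subseteq> \<Sigma>" and sp: "is_sparse P a b"
  note sp' = is_sparseD[OF sp]
  show "card (set P) \<le> sublen a b" by (rule card_set_le_sublen[OF sp])
  fix T :: "'a list"
  show "\<forall>(R, t) \<in> set_pmf (algorithm_A (stated P a b) P a b T). R \<subseteq> occurrences P T"
    using search_sound[OF correct_verifier_apostolico_giancarlo] memo_valid_0
    unfolding algorithm_A_def by fast
  show "\<forall>(R, t) \<in> set_pmf (algorithm_B (stated P a b) P a b T). R \<subseteq> occurrences P T"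
    using search_sound[OF correct_verifier_random_match] unfolding algorithm_B_def by fast
  show "\<forall>(R, t) \<in> set_pmf (algorithm_A (amended P a b) P a b T). R = occurrences P T"
  proof safe
    fix R t i
    assume res: "(R, t) \<in> set_pmf (algorithm_A (amended P a b) P a b T)"
    note search = res[unfolded algorithm_A_def]
    show "i \<in> R \<Longrightarrow> i \<in> occurrences P T"
      using search_sound[OF correct_verifier_apostolico_giancarlo _ search] memo_valid_0 by blast
    have "occurrences P T \<inter> {0..} \<subseteq> R"
      by (rule search_complete[OF correct_verifier_apostolico_giancarlo _ sp'(1-3) _ search])
        (rule memo_valid_0, rule amended_shift_safe[OF sp])
    then show "i \<in> occurrences P T \<Longrightarrow> i \<in> R" by auto
  qed
  show "\<forall>(R, t) \<in> set_pmf (algorithm_B (amended P a b) P a b T). R = occurrences P T"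
  proof safe
    fix R t i
    assume res: "(R, t) \<in> set_pmf (algorithm_B (amended P a b) P a b T)"
    note search = res[unfolded algorithm_B_def]
    show "i \<in> R \<Longrightarrow> i \<in> occurrences P T"
      using search_sound[OF correct_verifier_random_match _ search] by blast
    have "occurrences P T \<inter> {0..} \<subseteq> R"
      by (rule search_complete[OF correct_verifier_random_match _ sp'(1-3) _ search])
        (rule TrueI, rule amended_shift_safe[OF sp])
    then show "i \<in> occurrences P T \<Longrightarrow> i \<in> R" by auto
  qed
next
  fix \<Sigma> :: "'a set" and P a b m
  assume \<Sigma>: "finite \<Sigma>" "set P \<subseteq> \<Sigma>" and sp: "is_sparse P a b"
  let ?bound = "25 * (real m / real (min (sublen a b) (card \<Sigma>)))"
  show "\<forall>D \<in> {stated P a b, amended P a b}.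
      expected_time \<Sigma> m (algorithm_A D P a b) \<le> ?bound \<and>
      (2 \<le> card \<Sigma> \<longrightarrow> expected_time \<Sigma> m (algorithm_B D P a b) \<le> ?bound)"
  proof (intro ballI conjI impI)
    fix D assume D: "D \<in> {stated P a b, amended P a b}"
    show "expected_time \<Sigma> m (algorithm_B D P a b) \<le> ?bound" if "2 \<le> card \<Sigma>"
      by (rule expected_time_algorithm_B_le[OF \<Sigma>(1) that sp D])
    show "expected_time \<Sigma> m (algorithm_A D P a b) \<le> ?bound"
    proof (cases "2 \<le> card \<Sigma>")
      case True
      then show ?thesis by (rule expected_time_algorithm_A_le[OF \<Sigma>(1) _ sp D])
    next
      case False
      have "P \<noteq> []" using is_sparseD[OF sp] by auto
      then have "0 < card \<Sigma>" using \<Sigma> by (auto simp: card_gt_0_iff)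
      with False have card: "card \<Sigma> = 1" by linarith
      then obtain x where x: "\<Sigma> = {x}" by (auto simp: card_1_singleton_iff)
      \<comment> \<open>Over one letter the claimed bound becomes \<open>25 * m\<close>, which is
        above the \<open>7 * m\<close> obtained through the table \<open>M\<close>.\<close>
      have "min (sublen a b) (card \<Sigma>) = 1"
        using card is_sparseD[OF sp] by (simp add: sublen_def)
      then show ?thesis
        using expected_time_algorithm_A_unary_le[OF _ sp D, of x m] \<Sigma>(2) x by simp
    qed
  qed
qed simp

end
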